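(* Let $(\varphi,F):(\mathcal V,\mathfrak b)\to(\mathcal U,\mathfrak a)$ be a graded functor between map-graded categories. Let $M$ be an $\mathfrak a$-bimodule with induced $\mathfrak b$-bimodule $F^*M$. (1) There is for every $n\geq 0$ a canonical map $(F^*_M)^n:\mathbf C^n_{\mathcal U}(\mathfrak a,M)\to\mathbf C^n_{\mathcal V}(\mathfrak b,F^*M)$ given by $$(F^*_M)^n\big((\phi_{(u,A)})_{(u,A)}\big)=\big(\phi_{(\varphi(v),F(B))}\circ F^{\otimes n}\big)_{(v,B)}.$$ (2) The maps $(F^*_M)^n$ determine a morphism of complexes $F^*_M:\mathbf C_{\mathcal U}(\mathfrak a,M)\to\mathbf C_{\mathcal V}(\mathfrak b,F^*M)$. (3) If $(\varphi,F)$ is subcartesian, we have $F^*1_{\mathfrak a}\cong1_{\mathfrak b}$ and the maps $(F^*_{1_{\mathfrak a}})^n$ determine a morphism of $B_\infty$-algebras $F^*:\mathbf C_{\mathcal U}(\mathfrak a)\to\mathbf C_{\mathcal V}(\mathfrak b)$ with $$(F^* )^n\big((\phi_{(u,A)})_{(u,A)}\big)=\big(F^{-1}\circ\phi_{(\varphi(v),F(B))}\circ F^{\otimes n}\big)_{(v,B)}.$$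
   Context: Fix a commutative ring $k$. For a small category $\mathcal U$, a ($k$-linear) $\mathcal U$-graded category $\mathfrak a$ consists of a set $\mathfrak a_U$ for each object $U$; a $k$-module $\mathfrak a_u(A,A')$ for each $u:U\to U'$, $A\in\mathfrak a_U$, $A'\in\mathfrak a_{U'}$; compositions $\mathfrak a_{u'}(A',A'')\otimes_k\mathfrak a_u(A,A')\to\mathfrak a_{u'u}(A,A'')$ and identities $1_A\in\mathfrak a_{1_U}(A,A)$, associative and unital. A graded functor $(\varphi,F):(\mathcal V,\mathfrak b)\to(\mathcal U,\mathfrak a)$ is a functor $\varphi:\mathcal V\to\mathcal U$ with maps $\mathfrak b_V\to\mathfrak a_{\varphi(V)}$ and $k$-linear maps $F:\mathfrak b_v(B,B')\to\mathfrak a_{\varphi(v)}(F(B),F(B'))$ respecting compositions and identities. It is subcartesian if all the maps $\mathfrak b_v(B,B')\to\mathfrak a_{\varphi(v)}(F(B),F(B'))$ are isomorphisms. An $\mathfrak a$-bimodule $M$ consists of $k$-modules $M_u(A,A')$ for $u:U\to U'$, $A\in\mathfrak a_U$, $A'\in\mathfrak a_{U'}$ with associative unital left and right actions of $\mathfrak a$; $1_{\mathfrak a}$ is $\mathfrak a$ itself. $(F^*M)_v(B,B')=M_{\varphi(v)}(F(B),F(B'))$. An $n$-simplex $(u,A)$ of $\mathfrak a$ (element of $\mathcal N_n(\mathfrak a)$) consists of $U_0\xrightarrow{u_0}\cdots\xrightarrow{u_{n-1}}U_n$ in $\mathcal U$ and $A_i\in\mathfrak a_{U_i}$; $|u|=u_{n-1}\cdots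 u_0$ (identity of $U_0$ if $n=0$). The Hochschild complex is $$\mathbf C^n_{\mathcal U}(\mathfrak a,M)=\prod_{(u,A)\in\mathcal N_n(\mathfrak a)}\mathrm{Hom}_k(\mathfrak a_{u_{n-1}}(A_{n-1},A_n)\otimes\cdots\otimes\mathfrak a_{u_0}(A_0,A_1),M_{|u|}(A_0,A_n))$$ with the Hochschild differential $d\phi(a_n,\dots,a_0)=a_n\phi(a_{n-1},\dots,a_0)+\sum_{i=1}^n(-1)^i\phi(a_n,\dots,a_{n-i+1}a_{n-i},\dots,a_0)+(-1)^{n+1}\phi(a_n,\dots,a_1)a_0$. $\mathbf C_{\mathcal U}(\mathfrak a)=\mathbf C_{\mathcal U}(\mathfrak a,1_{\mathfrak a})$ is a $B_\infty$-algebra through the usual operations: the braces $\phi\{\psi_1,\dots,\psi_m\}$ (signed sums over all ways of inserting $\psi_1,\dots,\psi_m$, in order, into $\phi$ on disjoint consecutive blocks of arguments, where edges of the simplex in a block are replaced by their composite) and the cup product. *)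

theory Defs
  imports "HOL-Algebra.Module"
begin

section \<open>Linear and multilinear maps\<close>

locale linear_map = M: module k M + N: module k N
  for k :: "('k, 'r) ring_scheme" and M :: "('k, 'm) module" and N :: "('k, 'n) module" +
  fixes f :: "'m \<Rightarrow> 'n"
  assumes closed: "x \<in> carrier M \<Longrightarrow> f x \<in> carrier N"
    and add: "\<lbrakk>x \<in> carrier M; y \<in> carrier M\<rbrakk> \<Longrightarrow> f (x \<oplus>\<^bsub>M\<^esub> y) = f x \<oplus>\<^bsub>N\<^esub> f y"
    and smult: "\<lbrakk>c \<in> carrier k; x \<in> carrier M\<rbrakk> \<Longrightarrow> f (c \<odot>\<^bsub>M\<^esub> x) = c \<odot>\<^bsub>N\<^esub> f x"

definition linear_iso ::
  "('k, 'r) ring_scheme \<Rightarrow> ('k, 'm) module \<Rightarrow> ('k, 'n) module \<Rightarrow> ('m \<Rightarrow> 'n) \<Rightarrow> bool" where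
  "linear_iso k M N f \<longleftrightarrow> linear_map k M N f \<and> bij_betw f (carrier M) (carrier N)"

definition bilinear_map ::
  "('k, 'r) ring_scheme \<Rightarrow> ('k, 'l) module \<Rightarrow> ('k, 'm) module \<Rightarrow> ('k, 'n) module \<Rightarrow>
    ('l \<Rightarrow> 'm \<Rightarrow> 'n) \<Rightarrow> bool" where
  "bilinear_map k L M N f \<longleftrightarrow>
     (\<forall>x \<in> carrier L. linear_map k M N (\<lambda>y. f x y)) \<and>
     (\<forall>y \<in> carrier M. linear_map k L N (\<lambda>x. f x y))"

definition tuples :: "('k, 'm) module list \<Rightarrow> 'm list set" where
  "tuples Xs = {as. list_all2 (\<lambda>x X. x \<in> carrier X) as Xs}"

text \<open>\<open>multilinear_maps k Xs N\<close> is the \<open>k\<close>-module of linear maps from the tensor product of the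
  modules \<open>Xs\<close> to \<open>N\<close>, presented by its universal property as the module of multilinear maps.
  For \<open>Xs = []\<close> (tensor product \<open>k\<close>) it consists of the maps \<open>{[]} \<rightarrow> carrier N\<close>. Functions are
  \<open>undefined\<close> off their domain, so that equality in the module is equality in HOL. The ring
  fields \<open>mult\<close> and \<open>one\<close> of a module record are irrelevant.\<close>

definition multilinear_maps ::
  "('k, 'r) ring_scheme \<Rightarrow> ('k, 'm) module list \<Rightarrow> ('k, 'n) module \<Rightarrow> ('k, 'm list \<Rightarrow> 'n) module" where
  "multilinear_maps k Xs N =
    \<lparr>carrier = {f \<in> tuples Xs \<rightarrow>\<^sub>E carrier N.
        \<forall>as \<in> tuples Xs. \<forall>i < length Xs. linear_map k (Xs ! i) N (\<lambda>x. f (as[i := x]))},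
     mult = undefined, one = undefined,
     zero = (\<lambda>as \<in> tuples Xs. \<zero>\<^bsub>N\<^esub>),
     add = (\<lambda>f g. \<lambda>as \<in> tuples Xs. f as \<oplus>\<^bsub>N\<^esub> g as),
     smult = (\<lambda>c f. \<lambda>as \<in> tuples Xs. c \<odot>\<^bsub>N\<^esub> f as)\<rparr>"

definition product_module :: "'i set \<Rightarrow> ('i \<Rightarrow> ('k, 'm) module) \<Rightarrow> ('k, 'i \<Rightarrow> 'm) module" where
  "product_module I X =
    \<lparr>carrier = (\<Pi>\<^sub>E i \<in> I. carrier (X i)),
     mult = undefined, one = undefined,
     zero = (\<lambda>i \<in> I. \<zero>\<^bsub>X i\<^esub>),
     add = (\<lambda>f g. \<lambda>i \<in> I. f i \<oplus>\<^bsub>X i\<^esub> g i),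
     smult = (\<lambda>c f. \<lambda>i \<in> I. c \<odot>\<^bsub>X i\<^esub> f i)\<rparr>"

definition signed :: "('k, 'm) module \<Rightarrow> nat \<Rightarrow> 'm \<Rightarrow> 'm" where
  "signed N e x = (if even e then x else \<ominus>\<^bsub>N\<^esub> x)"


section \<open>Small categories, graded categories, graded functors, bimodules\<close>

text \<open>\<open>ccomp U v u\<close> is the composite \<open>v u\<close>, first \<open>u\<close> and then \<open>v\<close>.\<close>

record ('o, 'u) cat =
  Ob :: "'o set"
  Arr :: "'u set"
  src :: "'u \<Rightarrow> 'o"
  tgt :: "'u \<Rightarrow> 'o"
  ident :: "'o \<Rightarrow> 'u"
  ccomp :: "'u \<Rightarrow> 'u \<Rightarrow> 'u"

locale small_category =
  fixes U :: "('o, 'u) cat"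
  assumes src_closed: "u \<in> Arr U \<Longrightarrow> src U u \<in> Ob U"
    and tgt_closed: "u \<in> Arr U \<Longrightarrow> tgt U u \<in> Ob U"
    and ident_arr: "X \<in> Ob U \<Longrightarrow> ident U X \<in> Arr U"
    and src_ident: "X \<in> Ob U \<Longrightarrow> src U (ident U X) = X"
    and tgt_ident: "X \<in> Ob U \<Longrightarrow> tgt U (ident U X) = X"
    and comp_arr: "\<lbrakk>u \<in> Arr U; v \<in> Arr U; tgt U u = src U v\<rbrakk> \<Longrightarrow> ccomp U v u \<in> Arr U"
    and src_comp: "\<lbrakk>u \<in> Arr U; v \<in> Arr U; tgt U u = src U v\<rbrakk> \<Longrightarrow> src U (ccomp U v u) = src U u"
    and tgt_comp: "\<lbrakk>u \<in> Arr U; v \<in> Arr U; tgt U u = src U v\<rbrakk> \<Longrightarrow> tgt U (ccomp U v u) = tgt U v"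
    and ident_left: "u \<in> Arr U \<Longrightarrow> ccomp U (ident U (tgt U u)) u = u"
    and ident_right: "u \<in> Arr U \<Longrightarrow> ccomp U u (ident U (src U u)) = u"
    and comp_assoc: "\<lbrakk>u \<in> Arr U; v \<in> Arr U; w \<in> Arr U; tgt U u = src U v; tgt U v = src U w\<rbrakk>
      \<Longrightarrow> ccomp U (ccomp U w v) u = ccomp U w (ccomp U v u)"

text \<open>\<open>Mor a u A A'\<close> is the module \<open>a\<^sub>u(A, A')\<close>, and for \<open>u : X \<rightarrow> X'\<close> and \<open>v : X' \<rightarrow> X''\<close> the map
  \<open>mcomp a v u A A' A''\<close> is the composition \<open>a\<^sub>v(A', A'') \<times> a\<^sub>u(A, A') \<rightarrow> a\<^sub>v\<^sub>u(A, A'')\<close>. The sets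
  \<open>obs a X\<close> need not be disjoint, hence the argument \<open>X\<close> of \<open>unit\<close>.\<close>

record ('o, 'u, 'x, 'k, 'm) gcat =
  obs :: "'o \<Rightarrow> 'x set"
  Mor :: "'u \<Rightarrow> 'x \<Rightarrow> 'x \<Rightarrow> ('k, 'm) module"
  mcomp :: "'u \<Rightarrow> 'u \<Rightarrow> 'x \<Rightarrow> 'x \<Rightarrow> 'x \<Rightarrow> 'm \<Rightarrow> 'm \<Rightarrow> 'm"
  unit :: "'o \<Rightarrow> 'x \<Rightarrow> 'm"

locale graded_category = cring k + small_category U
  for k :: "('k, 'r) ring_scheme" and U :: "('o, 'u) cat" +
  fixes a :: "('o, 'u, 'x, 'k, 'm) gcat"
  assumes Mor_module: "\<lbrakk>u \<in> Arr U; A \<in> obs a (src U u); A' \<in> obs a (tgt U u)\<rbrakk>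
      \<Longrightarrow> module k (Mor a u A A')"
    and mcomp_bilinear: "\<lbrakk>u \<in> Arr U; v \<in> Arr U; tgt U u = src U v;
        A \<in> obs a (src U u); A' \<in> obs a (tgt U u); A'' \<in> obs a (tgt U v)\<rbrakk>
      \<Longrightarrow> bilinear_map k (Mor a v A' A'') (Mor a u A A') (Mor a (ccomp U v u) A A'')
            (mcomp a v u A A' A'')"
    and unit_closed: "\<lbrakk>X \<in> Ob U; A \<in> obs a X\<rbrakk> \<Longrightarrow> unit a X A \<in> carrier (Mor a (ident U X) A A)"
    and mcomp_assoc: "\<lbrakk>u \<in> Arr U; v \<in> Arr U; w \<in> Arr U; tgt U u = src U v; tgt U v = src U w;
        A \<in> obs a (src U u); A' \<in> obs a (tgt U u); A'' \<in> obs a (tgt U v); A''' \<in> obs a (tgt U w);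
        f \<in> carrier (Mor a u A A'); g \<in> carrier (Mor a v A' A''); h \<in> carrier (Mor a w A'' A''')\<rbrakk>
      \<Longrightarrow> mcomp a (ccomp U w v) u A A' A''' (mcomp a w v A' A'' A''' h g) f
        = mcomp a w (ccomp U v u) A A'' A''' h (mcomp a v u A A' A'' g f)"
    and unit_left: "\<lbrakk>u \<in> Arr U; A \<in> obs a (src U u); A' \<in> obs a (tgt U u); f \<in> carrier (Mor a u A A')\<rbrakk>
      \<Longrightarrow> mcomp a (ident U (tgt U u)) u A A' A' (unit a (tgt U u) A') f = f"
    and unit_right: "\<lbrakk>u \<in> Arr U; A \<in> obs a (src U u); A' \<in> obs a (tgt U u); f \<in> carrier (Mor a u A A')\<rbrakk>
      \<Longrightarrow> mcomp a u (ident U (src U u)) A A A' f (unit a (src U u) A) = f"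

record ('vo, 'v, 'y, 'n, 'uo, 'u, 'x, 'm) gfun =
  fob :: "'vo \<Rightarrow> 'uo"
  farr :: "'v \<Rightarrow> 'u"
  Fob :: "'vo \<Rightarrow> 'y \<Rightarrow> 'x"
  Fmor :: "'v \<Rightarrow> 'y \<Rightarrow> 'y \<Rightarrow> 'n \<Rightarrow> 'm"

locale graded_functor = dom: graded_category k V b + cod: graded_category k U a
  for k :: "('k, 'r) ring_scheme"
    and V :: "('vo, 'v) cat" and b :: "('vo, 'v, 'y, 'k, 'n) gcat"
    and U :: "('uo, 'u) cat" and a :: "('uo, 'u, 'x, 'k, 'm) gcat" +
  fixes F :: "('vo, 'v, 'y, 'n, 'uo, 'u, 'x, 'm) gfun"
  assumes fob_closed: "X \<in> Ob V \<Longrightarrow> fob F X \<in> Ob U"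
    and farr_closed: "v \<in> Arr V \<Longrightarrow> farr F v \<in> Arr U"
    and src_farr: "v \<in> Arr V \<Longrightarrow> src U (farr F v) = fob F (src V v)"
    and tgt_farr: "v \<in> Arr V \<Longrightarrow> tgt U (farr F v) = fob F (tgt V v)"
    and farr_ident: "X \<in> Ob V \<Longrightarrow> farr F (ident V X) = ident U (fob F X)"
    and farr_comp: "\<lbrakk>v \<in> Arr V; w \<in> Arr V; tgt V v = src V w\<rbrakk>
      \<Longrightarrow> farr F (ccomp V w v) = ccomp U (farr F w) (farr F v)"
    and Fob_closed: "\<lbrakk>X \<in> Ob V; B \<in> obs b X\<rbrakk> \<Longrightarrow> Fob F X B \<in> obs a (fob F X)"
    and Fmor_linear: "\<lbrakk>v \<in> Arr V; B \<in> obs b (src V v); B' \<in> obs b (tgt V v)\<rbrakk>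
      \<Longrightarrow> linear_map k (Mor b v B B')
            (Mor a (farr F v) (Fob F (src V v) B) (Fob F (tgt V v) B')) (Fmor F v B B')"
    and Fmor_comp: "\<lbrakk>v \<in> Arr V; w \<in> Arr V; tgt V v = src V w;
        B \<in> obs b (src V v); B' \<in> obs b (tgt V v); B'' \<in> obs b (tgt V w);
        f \<in> carrier (Mor b v B B'); g \<in> carrier (Mor b w B' B'')\<rbrakk>
      \<Longrightarrow> Fmor F (ccomp V w v) B B'' (mcomp b w v B B' B'' g f)
        = mcomp a (farr F w) (farr F v)
            (Fob F (src V v) B) (Fob F (tgt V v) B') (Fob F (tgt V w) B'')
            (Fmor F w B' B'' g) (Fmor F v B B' f)"
    and Fmor_unit: "\<lbrakk>X \<in> Ob V; B \<in> obs b X\<rbrakk>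
      \<Longrightarrow> Fmor F (ident V X) B B (unit b X B) = unit a (fob F X) (Fob F X B)"

locale subcartesian_functor = graded_functor +
  assumes Fmor_iso: "\<lbrakk>v \<in> Arr V; B \<in> obs b (src V v); B' \<in> obs b (tgt V v)\<rbrakk>
      \<Longrightarrow> linear_iso k (Mor b v B B')
            (Mor a (farr F v) (Fob F (src V v) B) (Fob F (tgt V v) B')) (Fmor F v B B')"

text \<open>For \<open>u : X \<rightarrow> X'\<close> and \<open>v : X' \<rightarrow> X''\<close>, \<open>lact M v u A A' A''\<close> is the left action
  \<open>a\<^sub>v(A', A'') \<times> M\<^sub>u(A, A') \<rightarrow> M\<^sub>v\<^sub>u(A, A'')\<close> and \<open>ract M v u A A' A''\<close> is the right action
  \<open>M\<^sub>v(A', A'') \<times> a\<^sub>u(A, A') \<rightarrow> M\<^sub>v\<^sub>u(A, A'')\<close>.\<close>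

record ('u, 'x, 'k, 'm, 'p) bimod =
  Bm :: "'u \<Rightarrow> 'x \<Rightarrow> 'x \<Rightarrow> ('k, 'p) module"
  lact :: "'u \<Rightarrow> 'u \<Rightarrow> 'x \<Rightarrow> 'x \<Rightarrow> 'x \<Rightarrow> 'm \<Rightarrow> 'p \<Rightarrow> 'p"
  ract :: "'u \<Rightarrow> 'u \<Rightarrow> 'x \<Rightarrow> 'x \<Rightarrow> 'x \<Rightarrow> 'p \<Rightarrow> 'm \<Rightarrow> 'p"

locale bimodule = graded_category k U a
  for k :: "('k, 'r) ring_scheme" and U :: "('o, 'u) cat" and a :: "('o, 'u, 'x, 'k, 'm) gcat" +
  fixes M :: "('u, 'x, 'k, 'm, 'p) bimod"
  assumes Bm_module: "\<lbrakk>u \<in> Arr U; A \<in> obs a (src U u); A' \<in> obs a (tgt U u)\<rbrakk>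
      \<Longrightarrow> module k (Bm M u A A')"
    and lact_bilinear: "\<lbrakk>u \<in> Arr U; v \<in> Arr U; tgt U u = src U v;
        A \<in> obs a (src U u); A' \<in> obs a (tgt U u); A'' \<in> obs a (tgt U v)\<rbrakk>
      \<Longrightarrow> bilinear_map k (Mor a v A' A'') (Bm M u A A') (Bm M (ccomp U v u) A A'')
            (lact M v u A A' A'')"
    and ract_bilinear: "\<lbrakk>u \<in> Arr U; v \<in> Arr U; tgt U u = src U v;
        A \<in> obs a (src U u); A' \<in> obs a (tgt U u); A'' \<in> obs a (tgt U v)\<rbrakk>
      \<Longrightarrow> bilinear_map k (Bm M v A' A'') (Mor a u A A') (Bm M (ccomp U v u) A A'')
            (ract M v u A A' A'')"
    and lact_assoc: "\<lbrakk>u \<in> Arr U; v \<in> Arr U; w \<in> Arr U; tgt U u = src U v; tgt U v = src U w;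
        A \<in> obs a (src U u); A' \<in> obs a (tgt U u); A'' \<in> obs a (tgt U v); A''' \<in> obs a (tgt U w);
        m \<in> carrier (Bm M u A A'); g \<in> carrier (Mor a v A' A''); h \<in> carrier (Mor a w A'' A''')\<rbrakk>
      \<Longrightarrow> lact M (ccomp U w v) u A A' A''' (mcomp a w v A' A'' A''' h g) m
        = lact M w (ccomp U v u) A A'' A''' h (lact M v u A A' A'' g m)"
    and ract_assoc: "\<lbrakk>u \<in> Arr U; v \<in> Arr U; w \<in> Arr U; tgt U u = src U v; tgt U v = src U w;
        A \<in> obs a (src U u); A' \<in> obs a (tgt U u); A'' \<in> obs a (tgt U v); A''' \<in> obs a (tgt U w);
        f \<in> carrier (Mor a u A A'); g \<in> carrier (Mor a v A' A''); m \<in> carrier (Bm M w A'' A''')\<rbrakk>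
      \<Longrightarrow> ract M (ccomp U w v) u A A' A''' (ract M w v A' A'' A''' m g) f
        = ract M w (ccomp U v u) A A'' A''' m (mcomp a v u A A' A'' g f)"
    and lact_ract: "\<lbrakk>u \<in> Arr U; v \<in> Arr U; w \<in> Arr U; tgt U u = src U v; tgt U v = src U w;
        A \<in> obs a (src U u); A' \<in> obs a (tgt U u); A'' \<in> obs a (tgt U v); A''' \<in> obs a (tgt U w);
        f \<in> carrier (Mor a u A A'); m \<in> carrier (Bm M v A' A''); h \<in> carrier (Mor a w A'' A''')\<rbrakk>
      \<Longrightarrow> ract M (ccomp U w v) u A A' A''' (lact M w v A' A'' A''' h m) f
        = lact M w (ccomp U v u) A A'' A''' h (ract M v u A A' A'' m f)"
    and lact_unit: "\<lbrakk>u \<in> Arr U; A \<in> obs a (src U u); A' \<in> obs a (tgt U u); m \<in> carrier (Bm M u A A')\<rbrakk>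
      \<Longrightarrow> lact M (ident U (tgt U u)) u A A' A' (unit a (tgt U u) A') m = m"
    and ract_unit: "\<lbrakk>u \<in> Arr U; A \<in> obs a (src U u); A' \<in> obs a (tgt U u); m \<in> carrier (Bm M u A A')\<rbrakk>
      \<Longrightarrow> ract M u (ident U (src U u)) A A A' m (unit a (src U u) A) = m"

definition unit_bimodule :: "('o, 'u, 'x, 'k, 'm) gcat \<Rightarrow> ('u, 'x, 'k, 'm, 'm) bimod" where
  "unit_bimodule a = \<lparr>Bm = Mor a, lact = mcomp a, ract = mcomp a\<rparr>"

definition pullback_bimodule ::
  "('vo, 'v) cat \<Rightarrow> ('vo, 'v, 'y, 'n, 'uo, 'u, 'x, 'm) gfun \<Rightarrow> ('u, 'x, 'k, 'm, 'p) bimod \<Rightarrow>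
    ('v, 'y, 'k, 'n, 'p) bimod" where
  "pullback_bimodule V F M =
    \<lparr>Bm = (\<lambda>v B B'. Bm M (farr F v) (Fob F (src V v) B) (Fob F (tgt V v) B')),
     lact = (\<lambda>w v B B' B'' g m. lact M (farr F w) (farr F v)
        (Fob F (src V v) B) (Fob F (tgt V v) B') (Fob F (tgt V w) B'') (Fmor F w B' B'' g) m),
     ract = (\<lambda>w v B B' B'' m f. ract M (farr F w) (farr F v)
        (Fob F (src V v) B) (Fob F (tgt V v) B') (Fob F (tgt V w) B'') m (Fmor F v B B' f))\<rparr>"

locale bimodule_iso = M: bimodule k U a M + N: bimodule k U a N
  for k :: "('k, 'r) ring_scheme" and U :: "('o, 'u) cat" and a :: "('o, 'u, 'x, 'k, 'm) gcat"
    and M :: "('u, 'x, 'k, 'm, 'p) bimod" and N :: "('u, 'x, 'k, 'm, 'q) bimod" +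
  fixes h :: "'u \<Rightarrow> 'x \<Rightarrow> 'x \<Rightarrow> 'p \<Rightarrow> 'q"
  assumes iso: "\<lbrakk>u \<in> Arr U; A \<in> obs a (src U u); A' \<in> obs a (tgt U u)\<rbrakk>
      \<Longrightarrow> linear_iso k (Bm M u A A') (Bm N u A A') (h u A A')"
    and h_lact: "\<lbrakk>u \<in> Arr U; v \<in> Arr U; tgt U u = src U v;
        A \<in> obs a (src U u); A' \<in> obs a (tgt U u); A'' \<in> obs a (tgt U v);
        g \<in> carrier (Mor a v A' A''); m \<in> carrier (Bm M u A A')\<rbrakk>
      \<Longrightarrow> h (ccomp U v u) A A'' (lact M v u A A' A'' g m) = lact N v u A A' A'' g (h u A A' m)"
    and h_ract: "\<lbrakk>u \<in> Arr U; v \<in> Arr U; tgt U u = src U v;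
        A \<in> obs a (src U u); A' \<in> obs a (tgt U u); A'' \<in> obs a (tgt U v);
        m \<in> carrier (Bm M v A' A''); f \<in> carrier (Mor a u A A')\<rbrakk>
      \<Longrightarrow> h (ccomp U v u) A A'' (ract M v u A A' A'' m f) = ract N v u A A' A'' (h v A' A'' m) f"


section \<open>The Hochschild complex\<close>

text \<open>A simplex \<open>U\<^sub>0 \<rightarrow> \<dots> \<rightarrow> U\<^sub>n\<close>, \<open>A\<^sub>i \<in> a\<^bsub>U\<^sub>i\<^esub>\<close>, is stored with \<open>base ! i = U\<^sub>i\<close>,
  \<open>edge ! i = u\<^sub>i\<close> and \<open>vert ! i = A\<^sub>i\<close>. Arguments of a cochain are indexed the same way: the list
  \<open>as\<close> with \<open>as ! i \<in> a\<^bsub>u\<^sub>i\<^esub>(A\<^sub>i, A\<^sub>i\<^sub>+\<^sub>1)\<close> stands for what is written \<open>(a\<^sub>n\<^sub>-\<^sub>1, \<dots>, a\<^sub>0)\<close> on paper,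
  so "further to the right" on paper means "smaller index" here.\<close>

record ('o, 'u, 'x) simplex =
  base :: "'o list"
  edge :: "'u list"
  vert :: "'x list"

type_synonym ('o, 'u, 'x, 'm, 'p) cochain = "('o, 'u, 'x) simplex \<Rightarrow> 'm list \<Rightarrow> 'p"

definition simplices ::
  "('o, 'u) cat \<Rightarrow> ('o, 'u, 'x, 'k, 'm) gcat \<Rightarrow> nat \<Rightarrow> ('o, 'u, 'x) simplex set" where
  "simplices U a n = {\<sigma>.
     length (base \<sigma>) = Suc n \<and> length (edge \<sigma>) = n \<and> length (vert \<sigma>) = Suc n \<and>
     (\<forall>i \<le> n. base \<sigma> ! i \<in> Ob U \<and> vert \<sigma> ! i \<in> obs a (base \<sigma> ! i)) \<and>
     (\<forall>i < n. edge \<sigma> ! i \<in> Arr U \<and> src U (edge \<sigma> ! i) = base \<sigma> ! i \<and>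
              tgt U (edge \<sigma> ! i) = base \<sigma> ! Suc i)}"

text \<open>\<open>total U \<sigma>\<close> is \<open>|u|\<close>, computed as \<open>u\<^sub>n\<^sub>-\<^sub>1 (\<dots> (u\<^sub>0 1))\<close>.\<close>

definition total :: "('o, 'u) cat \<Rightarrow> ('o, 'u, 'x) simplex \<Rightarrow> 'u" where
  "total U \<sigma> = fold (ccomp U) (edge \<sigma>) (ident U (hd (base \<sigma>)))"

definition edge_modules ::
  "('o, 'u, 'x, 'k, 'm) gcat \<Rightarrow> ('o, 'u, 'x) simplex \<Rightarrow> ('k, 'm) module list" where
  "edge_modules a \<sigma> =
    map (\<lambda>i. Mor a (edge \<sigma> ! i) (vert \<sigma> ! i) (vert \<sigma> ! Suc i)) [0..<length (edge \<sigma>)]"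

abbreviation args :: "('o, 'u, 'x, 'k, 'm) gcat \<Rightarrow> ('o, 'u, 'x) simplex \<Rightarrow> 'm list set" where
  "args a \<sigma> \<equiv> tuples (edge_modules a \<sigma>)"

definition coeff ::
  "('o, 'u) cat \<Rightarrow> ('u, 'x, 'k, 'm, 'p) bimod \<Rightarrow> ('o, 'u, 'x) simplex \<Rightarrow> ('k, 'p) module" where
  "coeff U M \<sigma> = Bm M (total U \<sigma>) (hd (vert \<sigma>)) (last (vert \<sigma>))"

definition cochains ::
  "('k, 'r) ring_scheme \<Rightarrow> ('o, 'u) cat \<Rightarrow> ('o, 'u, 'x, 'k, 'm) gcat \<Rightarrow> ('u, 'x, 'k, 'm, 'p) bimod \<Rightarrow>
    nat \<Rightarrow> ('k, ('o, 'u, 'x, 'm, 'p) cochain) module" where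
  "cochains k U a M n =
    product_module (simplices U a n) (\<lambda>\<sigma>. multilinear_maps k (edge_modules a \<sigma>) (coeff U M \<sigma>))"

text \<open>\<open>segment i j\<close> keeps the vertices \<open>i, \<dots>, j\<close>.\<close>

definition segment :: "nat \<Rightarrow> nat \<Rightarrow> ('o, 'u, 'x) simplex \<Rightarrow> ('o, 'u, 'x) simplex" where
  "segment i j \<sigma> =
    \<lparr>base = take (Suc j - i) (drop i (base \<sigma>)),
     edge = take (j - i) (drop i (edge \<sigma>)),
     vert = take (Suc j - i) (drop i (vert \<sigma>))\<rparr>"

definition seg_args :: "nat \<Rightarrow> nat \<Rightarrow> 'm list \<Rightarrow> 'm list" where
  "seg_args i j as = take (j - i) (drop i as)"

text \<open>\<open>face U j\<close> omits the inner vertex \<open>j\<close> and composes the two edges \<open>j - 1\<close> and \<open>j\<close> meeting there;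
  \<open>merge\<close> does the same to the arguments.\<close>

definition face :: "('o, 'u) cat \<Rightarrow> nat \<Rightarrow> ('o, 'u, 'x) simplex \<Rightarrow> ('o, 'u, 'x) simplex" where
  "face U j \<sigma> =
    \<lparr>base = take j (base \<sigma>) @ drop (Suc j) (base \<sigma>),
     edge = take (j - 1) (edge \<sigma>) @ ccomp U (edge \<sigma> ! j) (edge \<sigma> ! (j - 1)) # drop (Suc j) (edge \<sigma>),
     vert = take j (vert \<sigma>) @ drop (Suc j) (vert \<sigma>)\<rparr>"

definition merge ::
  "('o, 'u, 'x, 'k, 'm) gcat \<Rightarrow> nat \<Rightarrow> ('o, 'u, 'x) simplex \<Rightarrow> 'm list \<Rightarrow> 'm list" where
  "merge a j \<sigma> as = take (j - 1) as @
     mcomp a (edge \<sigma> ! j) (edge \<sigma> ! (j - 1)) (vert \<sigma> ! (j - 1)) (vert \<sigma> ! j) (vert \<sigma> ! Suc j)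
       (as ! j) (as ! (j - 1)) # drop (Suc j) as"

definition hochschild_d ::
  "('o, 'u) cat \<Rightarrow> ('o, 'u, 'x, 'k, 'm) gcat \<Rightarrow> ('u, 'x, 'k, 'm, 'p) bimod \<Rightarrow> nat \<Rightarrow>
    ('o, 'u, 'x, 'm, 'p) cochain \<Rightarrow> ('o, 'u, 'x, 'm, 'p) cochain" where
  "hochschild_d U a M n \<phi> = (\<lambda>\<sigma> \<in> simplices U a (Suc n). \<lambda>as \<in> args a \<sigma>.
     lact M (edge \<sigma> ! n) (total U (segment 0 n \<sigma>)) (vert \<sigma> ! 0) (vert \<sigma> ! n) (vert \<sigma> ! Suc n)
       (as ! n) (\<phi> (segment 0 n \<sigma>) (seg_args 0 n as))
     \<oplus>\<^bsub>coeff U M \<sigma>\<^esub>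
     (\<Oplus>\<^bsub>coeff U M \<sigma>\<^esub> i \<in> {1..n}. signed (coeff U M \<sigma>) i
        (\<phi> (face U (Suc n - i) \<sigma>) (merge a (Suc n - i) \<sigma> as)))
     \<oplus>\<^bsub>coeff U M \<sigma>\<^esub>
     signed (coeff U M \<sigma>) (Suc n)
       (ract M (total U (segment 1 (Suc n) \<sigma>)) (edge \<sigma> ! 0) (vert \<sigma> ! 0) (vert \<sigma> ! 1) (vert \<sigma> ! Suc n)
          (\<phi> (segment 1 (Suc n) \<sigma>) (seg_args 1 (Suc n) as)) (as ! 0)))"

record ('k, 'c) cochain_complex =
  cgrade :: "nat \<Rightarrow> ('k, 'c) module"
  cdiff :: "nat \<Rightarrow> 'c \<Rightarrow> 'c"

definition complex_hom ::
  "('k, 'r) ring_scheme \<Rightarrow> ('k, 'c) cochain_complex \<Rightarrow> ('k, 'd) cochain_complex \<Rightarrow>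
    (nat \<Rightarrow> 'c \<Rightarrow> 'd) \<Rightarrow> bool" where
  "complex_hom k C D f \<longleftrightarrow>
     (\<forall>n. linear_map k (cgrade C n) (cgrade D n) (f n)) \<and>
     (\<forall>n. \<forall>x \<in> carrier (cgrade C n). f (Suc n) (cdiff C n x) = cdiff D n (f n x))"

definition hochschild_complex ::
  "('k, 'r) ring_scheme \<Rightarrow> ('o, 'u) cat \<Rightarrow> ('o, 'u, 'x, 'k, 'm) gcat \<Rightarrow> ('u, 'x, 'k, 'm, 'p) bimod \<Rightarrow>
    ('k, ('o, 'u, 'x, 'm, 'p) cochain) cochain_complex" where
  "hochschild_complex k U a M = \<lparr>cgrade = cochains k U a M, cdiff = hochschild_d U a M\<rparr>"


section \<open>The \<open>B\<^sub>\<infinity>\<close>-structure\<close>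

text \<open>A \<open>B\<^sub>\<infinity>\<close>-structure on a graded module \<open>A\<close> is a differential and a multiplication making the tensor
  coalgebra of the shift \<open>\<Sigma>A\<close> a dg bialgebra. Both are determined by their components with values
  in \<open>\<Sigma>A\<close>: \<open>bdiff\<close> on \<open>(\<Sigma>A)\<^sup>\<otimes>\<^sup>n\<close>, of degree \<open>1\<close>, and \<open>bmult\<close> on \<open>(\<Sigma>A)\<^sup>\<otimes>\<^sup>p \<otimes> (\<Sigma>A)\<^sup>\<otimes>\<^sup>q\<close>, of degree \<open>0\<close>.
  The components act on homogeneous elements, given together with the list of their degrees in
  \<open>A\<close> (an element of degree \<open>d\<close> in \<open>A\<close> has degree \<open>d - 1\<close> in \<open>\<Sigma>A\<close>). Here \<open>A\<close> is concentrated in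
  degrees \<open>\<ge> 0\<close>, so components whose value would lie in negative degree carry no information.\<close>

record ('k, 'c) B_infinity =
  bgrade :: "nat \<Rightarrow> ('k, 'c) module"
  bdiff :: "nat list \<Rightarrow> 'c list \<Rightarrow> 'c"
  bmult :: "nat list \<Rightarrow> 'c list \<Rightarrow> nat list \<Rightarrow> 'c list \<Rightarrow> 'c"

definition diff_degree :: "nat list \<Rightarrow> int" where
  "diff_degree ds = int (sum_list ds) + 2 - int (length ds)"

definition mult_degree :: "nat list \<Rightarrow> nat list \<Rightarrow> int" where
  "mult_degree ds es = int (sum_list ds) + int (sum_list es) + 1 - int (length ds) - int (length es)"

definition homogeneous :: "(nat \<Rightarrow> ('k, 'c) module) \<Rightarrow> nat list \<Rightarrow> 'c list \<Rightarrow> bool" where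
  "homogeneous A ds xs \<longleftrightarrow> list_all2 (\<lambda>d x. x \<in> carrier (A d)) ds xs"

text \<open>As for \<^const>\<open>hom\<close>, source and target are just structures of the right signature: a morphism
  is a graded linear map that commutes with every component of the structure, that is, one whose
  extension to tensor coalgebras is compatible with differential and multiplication.\<close>

definition B_infinity_hom ::
  "('k, 'r) ring_scheme \<Rightarrow> ('k, 'c) B_infinity \<Rightarrow> ('k, 'd) B_infinity \<Rightarrow> (nat \<Rightarrow> 'c \<Rightarrow> 'd) \<Rightarrow> bool" where
  "B_infinity_hom k A B f \<longleftrightarrow>
     (\<forall>n. linear_map k (bgrade A n) (bgrade B n) (f n)) \<and>
     (\<forall>ds xs n. homogeneous (bgrade A) ds xs \<and> int n = diff_degree ds \<longrightarrow>
        f n (bdiff A ds xs) = bdiff B ds (map2 f ds xs)) \<and>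
     (\<forall>ds xs es ys n. homogeneous (bgrade A) ds xs \<and> homogeneous (bgrade A) es ys \<and>
        int n = mult_degree ds es \<longrightarrow>
        f n (bmult A ds xs es ys) = bmult B ds (map2 f ds xs) es (map2 f es ys))"

definition cup ::
  "('o, 'u) cat \<Rightarrow> ('o, 'u, 'x, 'k, 'm) gcat \<Rightarrow> nat \<Rightarrow> ('o, 'u, 'x, 'm, 'm) cochain \<Rightarrow>
    nat \<Rightarrow> ('o, 'u, 'x, 'm, 'm) cochain \<Rightarrow> ('o, 'u, 'x, 'm, 'm) cochain" where
  "cup U a p \<phi> q \<psi> = (\<lambda>\<sigma> \<in> simplices U a (p + q). \<lambda>as \<in> args a \<sigma>.
     mcomp a (total U (segment q (p + q) \<sigma>)) (total U (segment 0 q \<sigma>))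
       (vert \<sigma> ! 0) (vert \<sigma> ! q) (vert \<sigma> ! (p + q))
       (\<phi> (segment q (p + q) \<sigma>) (seg_args q (p + q) as))
       (\<psi> (segment 0 q \<sigma>) (seg_args 0 q as)))"

text \<open>An insertion of \<open>\<psi>\<^sub>1, \<dots>, \<psi>\<^sub>m\<close> in this order into \<open>\<phi>\<close> is given by the slots \<open>s\<^sub>1 > \<dots> > s\<^sub>m\<close> of
  \<open>\<phi>\<close> that receive them (\<open>\<psi>\<^sub>1\<close> leftmost on paper). Slot \<open>s\<close> of \<open>\<phi>\<close> then consumes the arguments between
  the vertices \<open>cut s\<close> and \<open>cut (s + 1)\<close>: a block of length \<open>q\<^sub>i\<close> if \<open>s = s\<^sub>i\<close> (possibly empty), a
  single argument otherwise.\<close>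

definition insertions :: "nat \<Rightarrow> nat \<Rightarrow> nat list set" where
  "insertions p m = {ss. length ss = m \<and> sorted_wrt (>) ss \<and> set ss \<subseteq> {..<p}}"

definition cut :: "nat list \<Rightarrow> nat list \<Rightarrow> nat \<Rightarrow> nat" where
  "cut qs ss s = (\<Sum>t<s. case map_of (zip ss qs) t of None \<Rightarrow> 1 | Some q \<Rightarrow> q)"

definition contract ::
  "('o, 'u) cat \<Rightarrow> nat \<Rightarrow> nat list \<Rightarrow> nat list \<Rightarrow> ('o, 'u, 'x) simplex \<Rightarrow> ('o, 'u, 'x) simplex" where
  "contract U p qs ss \<sigma> =
    \<lparr>base = map (\<lambda>s. base \<sigma> ! cut qs ss s) [0..<Suc p],
     edge = map (\<lambda>s. total U (segment (cut qs ss s) (cut qs ss (Suc s)) \<sigma>)) [0..<p],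
     vert = map (\<lambda>s. vert \<sigma> ! cut qs ss s) [0..<Suc p]\<rparr>"

definition insert_args ::
  "nat \<Rightarrow> nat list \<Rightarrow> ('o, 'u, 'x, 'm, 'm) cochain list \<Rightarrow> nat list \<Rightarrow> ('o, 'u, 'x) simplex \<Rightarrow>
    'm list \<Rightarrow> 'm list" where
  "insert_args p qs \<psi>s ss \<sigma> as =
    map (\<lambda>s. case map_of (zip ss \<psi>s) s of
        None \<Rightarrow> as ! cut qs ss s
      | Some \<psi> \<Rightarrow> \<psi> (segment (cut qs ss s) (cut qs ss (Suc s)) \<sigma>)
                     (seg_args (cut qs ss s) (cut qs ss (Suc s)) as)) [0..<p]"

text \<open>The sign is \<open>(-1)\<^sup>\<epsilon>\<close> with \<open>\<epsilon> = \<Sum>\<^sub>i (q\<^sub>i - 1) s\<^sub>i\<close>, where \<open>s\<^sub>i\<close> is the number of slots of \<open>\<phi>\<close> to the right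
  of \<open>\<psi>\<^sub>i\<close>; below \<open>q\<^sub>i + 1\<close> replaces \<open>q\<^sub>i - 1\<close> to stay in \<open>nat\<close>. This is the Koszul sign for inserting the
  shifted maps \<open>s \<psi>\<^sub>i (s\<^sup>-\<^sup>1)\<^sup>\<otimes>\<^sup>q\<close>. With it, for \<open>\<mu>\<close> the composition of \<open>a\<close> as a cochain of degree \<open>2\<close>, the
  differential above is \<open>d\<phi> = \<mu>{\<phi>} - (-1)\<^sup>p\<^sup>-\<^sup>1 \<phi>{\<mu>}\<close>, and \<open>\<mu>{\<phi>, \<psi>} = (-1)\<^sup>p\<^sup>-\<^sup>1 \<phi> \<union> \<psi>\<close>, for \<open>\<phi>\<close> of degree \<open>p\<close>.\<close>

definition brace ::
  "('o, 'u) cat \<Rightarrow> ('o, 'u, 'x, 'k, 'm) gcat \<Rightarrow> nat \<Rightarrow> ('o, 'u, 'x, 'm, 'm) cochain \<Rightarrow>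
    nat list \<Rightarrow> ('o, 'u, 'x, 'm, 'm) cochain list \<Rightarrow> ('o, 'u, 'x, 'm, 'm) cochain" where
  "brace U a p \<phi> qs \<psi>s =
    (\<lambda>\<sigma> \<in> simplices U a (p + sum_list qs - length qs). \<lambda>as \<in> args a \<sigma>.
     \<Oplus>\<^bsub>coeff U (unit_bimodule a) \<sigma>\<^esub> ss \<in> insertions p (length qs).
       signed (coeff U (unit_bimodule a) \<sigma>) (\<Sum>i<length qs. (qs ! i + 1) * ss ! i)
         (\<phi> (contract U p qs ss \<sigma>) (insert_args p qs \<psi>s ss \<sigma> as)))"

text \<open>The differential has components \<open>d\<close> and \<open>\<plusminus>\<close> cup product, the sign coming from the shift. The
  multiplication has components the braces \<open>\<phi>{\<psi>\<^sub>1, \<dots>, \<psi>\<^sub>m}\<close> (including \<open>\<phi>{} = \<phi>\<close>) for \<open>p = 1\<close>, and the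
  identity for \<open>(p, q) = (0, 1)\<close>. All others vanish.\<close>

definition hochschild_B_infinity ::
  "('k, 'r) ring_scheme \<Rightarrow> ('o, 'u) cat \<Rightarrow> ('o, 'u, 'x, 'k, 'm) gcat \<Rightarrow>
    ('k, ('o, 'u, 'x, 'm, 'm) cochain) B_infinity" where
  "hochschild_B_infinity k U a =
    (let C = cochains k U a (unit_bimodule a) in
     \<lparr>bgrade = C,
      bdiff = (\<lambda>ds xs. case (ds, xs) of
          ([p], [\<phi>]) \<Rightarrow> hochschild_d U a (unit_bimodule a) p \<phi>
        | ([p, q], [\<phi>, \<psi>]) \<Rightarrow> signed (C (p + q)) (p + 1) (cup U a p \<phi> q \<psi>)
        | _ \<Rightarrow> \<zero>\<^bsub>C (nat (diff_degree ds))\<^esub>),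
      bmult = (\<lambda>ds xs es ys. case (ds, xs, es, ys) of
          ([p], [\<phi>], qs, \<psi>s) \<Rightarrow> brace U a p \<phi> qs \<psi>s
        | ([], [], [q], [\<psi>]) \<Rightarrow> \<psi>
        | _ \<Rightarrow> \<zero>\<^bsub>C (nat (mult_degree ds es))\<^esub>)\<rparr>)"


section \<open>The maps induced on cochains\<close>

definition map_simplex ::
  "('vo, 'v, 'y, 'n, 'uo, 'u, 'x, 'm) gfun \<Rightarrow> ('vo, 'v, 'y) simplex \<Rightarrow> ('uo, 'u, 'x) simplex" where
  "map_simplex F \<sigma> =
    \<lparr>base = map (fob F) (base \<sigma>),
     edge = map (farr F) (edge \<sigma>),
     vert = map2 (Fob F) (base \<sigma>) (vert \<sigma>)\<rparr>"

definition map_args ::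
  "('vo, 'v, 'y, 'n, 'uo, 'u, 'x, 'm) gfun \<Rightarrow> ('vo, 'v, 'y) simplex \<Rightarrow> 'n list \<Rightarrow> 'm list" where
  "map_args F \<sigma> as =
    map (\<lambda>i. Fmor F (edge \<sigma> ! i) (vert \<sigma> ! i) (vert \<sigma> ! Suc i) (as ! i)) [0..<length (edge \<sigma>)]"

definition pullback_cochain ::
  "('vo, 'v) cat \<Rightarrow> ('vo, 'v, 'y, 'k, 'n) gcat \<Rightarrow> ('vo, 'v, 'y, 'n, 'uo, 'u, 'x, 'm) gfun \<Rightarrow> nat \<Rightarrow>
    ('uo, 'u, 'x, 'm, 'p) cochain \<Rightarrow> ('vo, 'v, 'y, 'n, 'p) cochain" where
  "pullback_cochain V b F n \<phi> =
    (\<lambda>\<sigma> \<in> simplices V b n. \<lambda>as \<in> args b \<sigma>. \<phi> (map_simplex F \<sigma>) (map_args F \<sigma> as))"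

text \<open>The map on cochains induced by a morphism \<open>h\<close> of coefficient bimodules.\<close>

definition coeff_map ::
  "('o, 'u) cat \<Rightarrow> ('o, 'u, 'x, 'k, 'm) gcat \<Rightarrow> ('u \<Rightarrow> 'x \<Rightarrow> 'x \<Rightarrow> 'p \<Rightarrow> 'q) \<Rightarrow> nat \<Rightarrow>
    ('o, 'u, 'x, 'm, 'p) cochain \<Rightarrow> ('o, 'u, 'x, 'm, 'q) cochain" where
  "coeff_map U a h n \<phi> =
    (\<lambda>\<sigma> \<in> simplices U a n. \<lambda>as \<in> args a \<sigma>.
       h (total U \<sigma>) (hd (vert \<sigma>)) (last (vert \<sigma>)) (\<phi> \<sigma> as))"

definition Fmor_inv ::
  "('vo, 'v, 'y, 'k, 'n) gcat \<Rightarrow> ('vo, 'v, 'y, 'n, 'uo, 'u, 'x, 'm) gfun \<Rightarrow>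
    'v \<Rightarrow> 'y \<Rightarrow> 'y \<Rightarrow> 'm \<Rightarrow> 'n" where
  "Fmor_inv b F v B B' = inv_into (carrier (Mor b v B B')) (Fmor F v B B')"

definition F_star ::
  "('vo, 'v) cat \<Rightarrow> ('vo, 'v, 'y, 'k, 'n) gcat \<Rightarrow> ('vo, 'v, 'y, 'n, 'uo, 'u, 'x, 'm) gfun \<Rightarrow> nat \<Rightarrow>
    ('uo, 'u, 'x, 'm, 'm) cochain \<Rightarrow> ('vo, 'v, 'y, 'n, 'n) cochain" where
  "F_star V b F n \<phi> = coeff_map V b (Fmor_inv b F) n (pullback_cochain V b F n \<phi>)"

end

theory Submission
  imports Defs
begin

text \<open>
  A graded functor sends an \<open>n\<close>-simplex \<open>\<sigma>\<close> of \<open>b\<close> to an \<open>n\<close>-simplex of \<open>a\<close> and a list of arguments over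
  \<open>\<sigma>\<close> to one over its image. The proof consists in observing that every ingredient of the Hochschild
  operations is compatible with this assignment: restricting to a segment, composing consecutive
  edges, multiplying neighbouring arguments, and acting on coefficients. Pulling back a cochain is
  precomposition with the assignment, whence it respects the operations term by term.

  The combinatorics is concentrated in one construction, the coarsening of a simplex along a
  weakly increasing map of vertices. Inner faces (in the differential) and contractions along an
  insertion (in the braces) are coarsenings, so two facts serve for both: coarsening does not change the
  composite of all edges (\<open>total_coarsen\<close>), and functors commute with it (\<open>map_simplex_coarsen\<close>).

  For a subcartesian functor the values have to be transported as well. Rather than with \<open>F\<^sup>-\<^sup>1\<close>, the argument is
  carried out with \<open>F\<close>, through a relation \<open>intertwines\<close> between cochains \<open>\<psi>\<close> of \<open>b\<close> and \<open>\<phi>\<close> of \<open>a\<close>, which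
  says that \<open>h \<circ> \<psi>\<close> and \<open>\<phi>\<close> agree along \<open>F\<close> for a morphism \<open>h\<close> from the coefficients of \<open>\<psi>\<close> to the pullback of
  those of \<open>\<phi>\<close>. For \<open>h = id\<close> the relation says that \<open>\<psi>\<close> is the pullback of \<open>\<phi>\<close>. For \<open>h = F\<close> all structure maps are
  preserved by \<open>h\<close> simply because \<open>F\<close> is a functor, and the relation holds between the results of an
  operation as soon as it holds between its inputs (\<open>intertwines_hochschild_d\<close>, \<open>intertwines_cup\<close>,
  \<open>intertwines_brace\<close>). The bijectivity of \<open>F\<close> on morphisms enters at the very end: it makes \<open>F\<^sup>*\<phi>\<close> the
  unique cochain that intertwines with \<open>\<phi>\<close> (\<open>F_star_eqI\<close>), which turns the three relations into the
  equations defining a morphism of \<open>B\<^sub>\<infinity>\<close>-algebras.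
\<close>


section \<open>Linear and multilinear maps\<close>

lemma linear_mapI:
  assumes "module k M" "module k N"
    and "\<And>x. x \<in> carrier M \<Longrightarrow> f x \<in> carrier N"
    and "\<And>x y. \<lbrakk>x \<in> carrier M; y \<in> carrier M\<rbrakk> \<Longrightarrow> f (x \<oplus>\<^bsub>M\<^esub> y) = f x \<oplus>\<^bsub>N\<^esub> f y"
    and "\<And>c x. \<lbrakk>c \<in> carrier k; x \<in> carrier M\<rbrakk> \<Longrightarrow> f (c \<odot>\<^bsub>M\<^esub> x) = c \<odot>\<^bsub>N\<^esub> f x"
  shows "linear_map k M N f"
  using assms by (simp add: linear_map_def linear_map_axioms_def)

context linear_map
begin

lemma map_zero: "f \<zero>\<^bsub>M\<^esub> = \<zero>\<^bsub>N\<^esub>"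
  using smult[of "\<zero>\<^bsub>k\<^esub>" "\<zero>\<^bsub>M\<^esub>"] closed[of "\<zero>\<^bsub>M\<^esub>"] by simp

lemma map_uminus: "x \<in> carrier M \<Longrightarrow> f (\<ominus>\<^bsub>M\<^esub> x) = \<ominus>\<^bsub>N\<^esub> f x"
  using smult[of "\<ominus>\<^bsub>k\<^esub> \<one>\<^bsub>k\<^esub>" x] closed[of x] by (simp add: M.smult_l_minus N.smult_l_minus)

lemma map_signed: "x \<in> carrier M \<Longrightarrow> f (signed M e x) = signed N e (f x)"
  by (simp add: signed_def map_uminus)

lemma map_finsum:
  assumes "\<And>i. i \<in> I \<Longrightarrow> g i \<in> carrier M"
  shows "f (\<Oplus>\<^bsub>M\<^esub> i \<in> I. g i) = (\<Oplus>\<^bsub>N\<^esub> i \<in> I. f (g i))"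
  using assms
proof (induction I rule: infinite_finite_induct)
  case (insert i I)
  then show ?case
    by (simp add: Pi_def add closed M.M.finsum_closed)
qed (simp_all add: map_zero)

end

lemma signed_closed:
  assumes "module k M" "x \<in> carrier M"
  shows "signed M e x \<in> carrier M"
proof -
  interpret module k M by fact
  show ?thesis using assms(2) by (simp add: signed_def)
qed

lemma linear_map_id: "module k M \<Longrightarrow> linear_map k M M (\<lambda>x. x)"
  by (rule linear_mapI) auto

lemma linear_map_cong:
  assumes "linear_map k M N f" "\<And>x. x \<in> carrier M \<Longrightarrow> f x = g x"
  shows "linear_map k M N g"
proof -
  interpret linear_map k M N f by fact
  show ?thesis
    by (rule linear_mapI) (simp_all add: assms(2)[symmetric] closed add smult M.module_axioms N.module_axioms)
qed

lemma linear_map_comp: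
  assumes "linear_map k L M f" "linear_map k M N g"
  shows "linear_map k L N (\<lambda>x. g (f x))"
proof -
  interpret f: linear_map k L M f by fact
  interpret g: linear_map k M N g by fact
  show ?thesis
    by (rule linear_mapI)
      (simp_all add: f.closed g.closed f.add g.add f.smult g.smult f.M.module_axioms g.N.module_axioms)
qed

text \<open>The inverse is linear because every element of \<open>N\<close> has the form \<open>f x\<close>.\<close>

lemma linear_map_inv:
  assumes "linear_iso k M N f"
  shows "linear_iso k N M (inv_into (carrier M) f)"
proof -
  interpret linear_map k M N f using assms by (simp add: linear_iso_def)
  have bij: "bij_betw f (carrier M) (carrier N)" using assms by (simp add: linear_iso_def)
  let ?g = "inv_into (carrier M) f"
  have g: "?g y \<in> carrier M" "f (?g y) = y" if "y \<in> carrier N" for y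
    using that bij bij_betw_imp_surj_on f_inv_into_f inv_into_into by metis+
  have gf: "?g (f x) = x" if "x \<in> carrier M" for x
    using that bij by (simp add: bij_betw_inv_into_left)
  have "linear_map k N M ?g"
  proof (rule linear_mapI)
    fix x y assume xy: "x \<in> carrier N" "y \<in> carrier N"
    then have "?g (x \<oplus>\<^bsub>N\<^esub> y) = ?g (f (?g x \<oplus>\<^bsub>M\<^esub> ?g y))" by (simp add: add g)
    then show "?g (x \<oplus>\<^bsub>N\<^esub> y) = ?g x \<oplus>\<^bsub>M\<^esub> ?g y" using xy by (simp add: gf g)
  next
    fix c x assume cx: "c \<in> carrier k" "x \<in> carrier N"
    then have "?g (c \<odot>\<^bsub>N\<^esub> x) = ?g (f (c \<odot>\<^bsub>M\<^esub> ?g x))" by (simp add: smult g)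
    then show "?g (c \<odot>\<^bsub>N\<^esub> x) = c \<odot>\<^bsub>M\<^esub> ?g x" using cx by (simp add: gf g)
  qed (simp_all add: g M.module_axioms N.module_axioms)
  then show ?thesis using bij by (simp add: linear_iso_def bij_betw_inv_into)
qed

lemma product_moduleI:
  assumes k: "cring k" and X: "\<And>i. i \<in> I \<Longrightarrow> module k (X i)"
  shows "module k (product_module I X)"
proof -
  note [simp] = abelian_groupE(1,2)[OF module.axioms(2)[OF X]] abelian_groupE(5)[OF module.axioms(2)[OF X]]
    module.smult_closed[OF X]
  note am = abelian_group.axioms(1)[OF module.axioms(2)[OF X]]
  show ?thesis
  proof (rule moduleI[OF k])
    show "abelian_group (product_module I X)"
    proof (rule abelian_groupI)
      fix x assume x: "x \<in> carrier (product_module I X)"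
      have "(\<lambda>i\<in>I. \<ominus>\<^bsub>X i\<^esub> x i) \<in> carrier (product_module I X)"
        using x X by (auto simp: product_module_def PiE_iff intro!: abelian_group.a_inv_closed module.axioms(2))
      moreover have "(\<lambda>i\<in>I. \<ominus>\<^bsub>X i\<^esub> x i) \<oplus>\<^bsub>product_module I X\<^esub> x = \<zero>\<^bsub>product_module I X\<^esub>"
        using x X by (auto simp: product_module_def intro!: restrict_ext abelian_group.l_neg module.axioms(2) simp: PiE_iff)
      ultimately show "\<exists>y\<in>carrier (product_module I X). y \<oplus>\<^bsub>product_module I X\<^esub> x = \<zero>\<^bsub>product_module I X\<^esub>"
        by blast
    qed (auto simp: product_module_def PiE_iff extensional_def fun_eq_iff
        abelian_monoid.a_ac[OF am] abelian_monoid.r_zero[OF am])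
  qed (auto simp: product_module_def PiE_iff extensional_def fun_eq_iff module.smult_l_distr[OF X]
      module.smult_r_distr[OF X] module.smult_assoc1[OF X] module.smult_one[OF X]
      intro: abelian_groupE(1)[OF cring.axioms(1)[THEN ring.axioms(1)]])
qed

lemma tuples_iff:
  "as \<in> tuples Xs \<longleftrightarrow> length as = length Xs \<and> (\<forall>i < length Xs. as ! i \<in> carrier (Xs ! i))"
  by (auto simp: tuples_def list_all2_conv_all_nth)

lemma tuples_update: "\<lbrakk>as \<in> tuples Xs; x \<in> carrier (Xs ! i)\<rbrakk> \<Longrightarrow> as[i := x] \<in> tuples Xs"
  by (cases "i < length as") (auto simp: tuples_iff nth_list_update)

lemma linear_map_zero:
  assumes "module k M" "module k N" shows "linear_map k M N (\<lambda>_. \<zero>\<^bsub>N\<^esub>)"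
proof -
  interpret M: module k M by fact
  interpret N: module k N by fact
  show ?thesis by (rule linear_mapI) (simp_all add: assms)
qed

lemma linear_map_add:
  assumes "linear_map k M N f" "linear_map k M N g"
  shows "linear_map k M N (\<lambda>x. f x \<oplus>\<^bsub>N\<^esub> g x)"
proof -
  interpret f: linear_map k M N f by fact
  interpret g: linear_map k M N g by fact
  show ?thesis
    by (rule linear_mapI)
      (simp_all add: f.closed g.closed f.add g.add f.smult g.smult f.M.module_axioms f.N.module_axioms
        f.N.smult_r_distr f.N.a_ac)
qed

lemma linear_map_smult:
  assumes "linear_map k M N f" "c \<in> carrier k"
  shows "linear_map k M N (\<lambda>x. c \<odot>\<^bsub>N\<^esub> f x)"
proof -
  interpret f: linear_map k M N f by fact
  show ?thesis
    by (rule linear_mapI)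
      (simp_all add: assms f.closed f.add f.smult f.M.module_axioms f.N.module_axioms
        f.N.smult_r_distr f.N.smult_assoc1[symmetric] f.M.R.m_comm)
qed

lemma multilinear_mapsI:
  assumes "f \<in> extensional (tuples Xs)" "\<And>as. as \<in> tuples Xs \<Longrightarrow> f as \<in> carrier N"
    and "\<And>as i. \<lbrakk>as \<in> tuples Xs; i < length Xs\<rbrakk> \<Longrightarrow> linear_map k (Xs ! i) N (\<lambda>x. f (as[i := x]))"
  shows "f \<in> carrier (multilinear_maps k Xs N)"
  using assms by (auto simp: multilinear_maps_def PiE_iff)

lemma multilinear_maps_moduleI:
  assumes N: "module k N" and Xs: "\<And>i. i < length Xs \<Longrightarrow> module k (Xs ! i)"
  shows "module k (multilinear_maps k Xs N)"
proof -
  interpret N: module k N by fact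
  let ?L = "multilinear_maps k Xs N"
  let ?P = "product_module (tuples Xs) (\<lambda>_. N)"
  have P: "module k ?P" by (rule product_moduleI) (use N module.axioms in auto)
  interpret P: module k ?P by fact
  \<comment> \<open>The multilinear maps form a submodule of the module of all maps \<open>tuples Xs \<rightarrow> N\<close>.\<close>
  have sub: "x \<in> carrier ?P" if "x \<in> carrier ?L" for x
    using that by (auto simp: multilinear_maps_def product_module_def)
  have ops: "x \<oplus>\<^bsub>?L\<^esub> y = x \<oplus>\<^bsub>?P\<^esub> y" "c \<odot>\<^bsub>?L\<^esub> x = c \<odot>\<^bsub>?P\<^esub> x" "\<zero>\<^bsub>?L\<^esub> = \<zero>\<^bsub>?P\<^esub>" for c x y
    by (simp_all add: multilinear_maps_def product_module_def)
  have add: "x \<oplus>\<^bsub>?L\<^esub> y \<in> carrier ?L" if "x \<in> carrier ?L" "y \<in> carrier ?L" for x y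
  proof (rule multilinear_mapsI)
    fix as i assume as: "as \<in> tuples Xs" "i < length Xs"
    show "linear_map k (Xs ! i) N (\<lambda>z. (x \<oplus>\<^bsub>?L\<^esub> y) (as[i := z]))"
      by (rule linear_map_cong[OF linear_map_add[of _ _ _ "\<lambda>z. x (as[i:=z])" "\<lambda>z. y (as[i:=z])"]])
        (use that as tuples_update[OF as(1)] in \<open>auto simp: multilinear_maps_def\<close>)
  qed (use that in \<open>auto simp: multilinear_maps_def PiE_iff\<close>)
  have smult: "c \<odot>\<^bsub>?L\<^esub> x \<in> carrier ?L" if "c \<in> carrier k" "x \<in> carrier ?L" for c x
  proof (rule multilinear_mapsI)
    fix as i assume as: "as \<in> tuples Xs" "i < length Xs"
    show "linear_map k (Xs ! i) N (\<lambda>z. (c \<odot>\<^bsub>?L\<^esub> x) (as[i := z]))"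
      by (rule linear_map_cong[OF linear_map_smult[of _ _ _ "\<lambda>z. x (as[i:=z])" c]])
        (use that as tuples_update[OF as(1)] in \<open>auto simp: multilinear_maps_def\<close>)
  qed (use that in \<open>auto simp: multilinear_maps_def PiE_iff\<close>)
  have zero: "\<zero>\<^bsub>?L\<^esub> \<in> carrier ?L"
  proof (rule multilinear_mapsI)
    fix as i assume as: "as \<in> tuples Xs" "i < length Xs"
    show "linear_map k (Xs ! i) N (\<lambda>z. (\<zero>\<^bsub>?L\<^esub>) (as[i := z]))"
      by (rule linear_map_cong[OF linear_map_zero[OF Xs N]])
        (use as tuples_update[OF as(1)] in \<open>auto simp: multilinear_maps_def\<close>)
  qed (auto simp: multilinear_maps_def)
  show ?thesis
  proof (rule moduleI)
    show "abelian_group ?L"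
    proof (rule abelian_groupI)
      fix x assume x: "x \<in> carrier ?L"
      then have "(\<ominus>\<^bsub>k\<^esub> \<one>\<^bsub>k\<^esub>) \<odot>\<^bsub>?P\<^esub> x \<oplus>\<^bsub>?P\<^esub> x = \<zero>\<^bsub>?P\<^esub>"
        by (simp add: P.smult_l_minus sub P.l_neg)
      then show "\<exists>y\<in>carrier ?L. y \<oplus>\<^bsub>?L\<^esub> x = \<zero>\<^bsub>?L\<^esub>"
        using smult[OF _ x, of "\<ominus>\<^bsub>k\<^esub> \<one>\<^bsub>k\<^esub>"] by (auto simp: ops)
    qed (use add zero sub in \<open>auto simp: ops P.a_ac\<close>)
  qed (use smult add sub in \<open>auto simp: ops P.smult_l_distr P.smult_r_distr P.smult_assoc1 N.R.cring_axioms\<close>)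
qed


section \<open>Simplices and their coarsenings\<close>

text \<open>A weakly increasing map \<open>c\<close> selects the vertices that are kept, and the edges between consecutive
  kept vertices are composed. If consecutive values of \<open>c\<close> coincide, the new edge is an identity; this is how a
  \<open>0\<close>-cochain is inserted. The inner faces of the differential and the contractions of the braces are
  both of this form.\<close>

definition coarsen ::
  "('o, 'u) cat \<Rightarrow> (nat \<Rightarrow> nat) \<Rightarrow> nat \<Rightarrow> ('o, 'u, 'x) simplex \<Rightarrow> ('o, 'u, 'x) simplex" where
  "coarsen U c p \<sigma> =
    \<lparr>base = map (\<lambda>s. base \<sigma> ! c s) [0..<Suc p],
     edge = map (\<lambda>s. total U (segment (c s) (c (Suc s)) \<sigma>)) [0..<p],
     vert = map (\<lambda>s. vert \<sigma> ! c s) [0..<Suc p]\<rparr>"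

lemma contract_eq_coarsen: "contract U p qs ss = coarsen U (cut qs ss) p"
  by (simp add: contract_def coarsen_def fun_eq_iff)

lemma simplex_lengths:
  assumes "\<sigma> \<in> simplices U a n"
  shows "length (base \<sigma>) = Suc n" "length (edge \<sigma>) = n" "length (vert \<sigma>) = Suc n"
  using assms by (simp_all add: simplices_def)

lemma simplexD:
  assumes "\<sigma> \<in> simplices U a n"
  shows "i \<le> n \<Longrightarrow> base \<sigma> ! i \<in> Ob U" "i \<le> n \<Longrightarrow> vert \<sigma> ! i \<in> obs a (base \<sigma> ! i)"
    "i < n \<Longrightarrow> edge \<sigma> ! i \<in> Arr U" "i < n \<Longrightarrow> src U (edge \<sigma> ! i) = base \<sigma> ! i"
    "i < n \<Longrightarrow> tgt U (edge \<sigma> ! i) = base \<sigma> ! Suc i"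
  using assms by (simp_all add: simplices_def)

lemma simplex_ends:
  assumes "\<sigma> \<in> simplices U a n"
  shows "hd (base \<sigma>) = base \<sigma> ! 0" "hd (vert \<sigma>) = vert \<sigma> ! 0" "last (vert \<sigma>) = vert \<sigma> ! n"
  using simplex_lengths[OF assms] by (auto simp: hd_conv_nth last_conv_nth simp flip: length_greater_0_conv)

lemma args_iff:
  "as \<in> args a \<sigma> \<longleftrightarrow> length as = length (edge \<sigma>) \<and>
    (\<forall>i < length (edge \<sigma>). as ! i \<in> carrier (Mor a (edge \<sigma> ! i) (vert \<sigma> ! i) (vert \<sigma> ! Suc i)))"
  by (simp add: tuples_iff edge_modules_def)

lemma segment_all: "\<sigma> \<in> simplices U a n \<Longrightarrow> segment 0 n \<sigma> = \<sigma>"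
  by (simp add: segment_def simplex_lengths)

lemma segment_nth:
  assumes "\<sigma> \<in> simplices U a n" "i \<le> j" "j \<le> n"
  shows "t \<le> j - i \<Longrightarrow> base (segment i j \<sigma>) ! t = base \<sigma> ! (i + t)"
    "t \<le> j - i \<Longrightarrow> vert (segment i j \<sigma>) ! t = vert \<sigma> ! (i + t)"
    "t < j - i \<Longrightarrow> edge (segment i j \<sigma>) ! t = edge \<sigma> ! (i + t)"
  using assms simplex_lengths[OF assms(1)] by (simp_all add: segment_def)

lemma segment_lengths:
  assumes "\<sigma> \<in> simplices U a n" "i \<le> j" "j \<le> n"
  shows "length (base (segment i j \<sigma>)) = Suc (j - i)" "length (edge (segment i j \<sigma>)) = j - i"
    "length (vert (segment i j \<sigma>)) = Suc (j - i)"
  using assms simplex_lengths[OF assms(1)] by (auto simp: segment_def)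

lemma segment_simplex:
  assumes "\<sigma> \<in> simplices U a n" "i \<le> j" "j \<le> n"
  shows "segment i j \<sigma> \<in> simplices U a (j - i)"
  using assms simplexD[OF assms(1)]
  by (auto simp: simplices_def segment_nth[OF assms] segment_lengths[OF assms])

lemma segment_ends:
  assumes "\<sigma> \<in> simplices U a n" "i \<le> j" "j \<le> n"
  shows "hd (base (segment i j \<sigma>)) = base \<sigma> ! i"
    "hd (vert (segment i j \<sigma>)) = vert \<sigma> ! i" "last (vert (segment i j \<sigma>)) = vert \<sigma> ! j"
  using assms by (simp_all add: simplex_ends[OF segment_simplex[OF assms]] segment_nth[OF assms])

lemma seg_args_closed:
  assumes "\<sigma> \<in> simplices U a n" "i \<le> j" "j \<le> n" "as \<in> args a \<sigma>"
  shows "seg_args i j as \<in> args a (segment i j \<sigma>)"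
  using assms(2-) by (auto simp: args_iff seg_args_def segment_lengths[OF assms(1-3)]
      segment_nth[OF assms(1-3)] simplex_lengths[OF assms(1)])

context graded_category
begin

lemma total_segment_refl:
  assumes "\<sigma> \<in> simplices U a n" "i \<le> n"
  shows "total U (segment i i \<sigma>) = ident U (base \<sigma> ! i)"
  using assms by (simp add: total_def segment_ends(1)) (simp add: segment_def)

lemma total_segment_Suc:
  assumes \<sigma>: "\<sigma> \<in> simplices U a n" and ij: "i \<le> j" "j < n"
  shows "total U (segment i (Suc j) \<sigma>) = ccomp U (edge \<sigma> ! j) (total U (segment i j \<sigma>))"
proof -
  have "edge (segment i (Suc j) \<sigma>) = edge (segment i j \<sigma>) @ [edge \<sigma> ! j]"
    using simplex_lengths[OF \<sigma>] ij by (simp add: segment_def Suc_diff_le take_Suc_conv_app_nth)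
  then show ?thesis
    using assms by (simp add: total_def segment_ends(1))
qed

lemma total_segment:
  assumes \<sigma>: "\<sigma> \<in> simplices U a n" and ij: "i \<le> j" "j \<le> n"
  shows "total U (segment i j \<sigma>) \<in> Arr U" "src U (total U (segment i j \<sigma>)) = base \<sigma> ! i"
    "tgt U (total U (segment i j \<sigma>)) = base \<sigma> ! j"
proof -
  have "total U (segment i j \<sigma>) \<in> Arr U \<and> src U (total U (segment i j \<sigma>)) = base \<sigma> ! i \<and>
    tgt U (total U (segment i j \<sigma>)) = base \<sigma> ! j" using ij
  proof (induction j rule: dec_induct)
    case base
    then show ?case
      using simplexD[OF \<sigma>] by (simp add: total_segment_refl[OF \<sigma>] ident_arr src_ident tgt_ident)
  next
    case (step j)
    then show ?case
      using simplexD[OF \<sigma>, of j] by (simp add: total_segment_Suc[OF \<sigma>] comp_arr src_comp tgt_comp)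
  qed
  then show "total U (segment i j \<sigma>) \<in> Arr U" "src U (total U (segment i j \<sigma>)) = base \<sigma> ! i"
    "tgt U (total U (segment i j \<sigma>)) = base \<sigma> ! j" by blast+
qed

lemma total_closed:
  assumes "\<sigma> \<in> simplices U a n"
  shows "total U \<sigma> \<in> Arr U" "src U (total U \<sigma>) = base \<sigma> ! 0" "tgt U (total U \<sigma>) = base \<sigma> ! n"
  using total_segment[OF assms, of 0 n] by (simp_all add: segment_all[OF assms])

text \<open>Associativity of composition in the form in which it enters everywhere below: the composite of a
  path may be computed in two blocks.\<close>

lemma total_segment_append:
  assumes \<sigma>: "\<sigma> \<in> simplices U a n" and "i \<le> j" "j \<le> l" "l \<le> n"
  shows "total U (segment i l \<sigma>) = ccomp U (total U (segment j l \<sigma>)) (total U (segment i j \<sigma>))"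
  using assms(3,4)
proof (induction l rule: dec_induct)
  case base
  then show ?case
    using assms(2) ident_left[of "total U (segment i j \<sigma>)"] total_segment[OF \<sigma>, of i j]
    by (simp add: total_segment_refl[OF \<sigma>])
next
  case (step l)
  then show ?case
    using assms(2) simplexD[OF \<sigma>, of l] total_segment[OF \<sigma>, of i j] total_segment[OF \<sigma>, of j l]
    by (simp add: total_segment_Suc[OF \<sigma>] comp_assoc)
qed

lemma total_segment_edge:
  assumes \<sigma>: "\<sigma> \<in> simplices U a n" and "i < n"
  shows "total U (segment i (Suc i) \<sigma>) = edge \<sigma> ! i"
  using assms(2) simplexD[OF \<sigma>, of i] ident_right[of "edge \<sigma> ! i"]
  by (simp add: total_segment_Suc[OF \<sigma>] total_segment_refl[OF \<sigma>])

context
  fixes c :: "nat \<Rightarrow> nat" and p n :: nat and \<sigma> :: "('o, 'u, 'x) simplex"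
  assumes \<sigma>: "\<sigma> \<in> simplices U a n"
    and c_step: "\<And>s. s < p \<Longrightarrow> c s \<le> c (Suc s)" and c_last: "c p \<le> n"
begin

private lemma c_mono: "\<lbrakk>s \<le> t; t \<le> p\<rbrakk> \<Longrightarrow> c s \<le> c t"
proof (induction t rule: dec_induct)
  case (step t)
  then show ?case using c_step[of t] by simp
qed simp

private lemma c_bound: "s \<le> p \<Longrightarrow> c s \<le> n"
  using c_mono[of s p] c_last by simp

lemma coarsen_simplex: "coarsen U c p \<sigma> \<in> simplices U a p"
  using c_step c_bound simplexD[OF \<sigma>]
  by (auto simp: simplices_def coarsen_def less_Suc_eq_le total_segment[OF \<sigma>] simp del: upt_Suc)

lemma total_segment_coarsen:
  assumes "i \<le> j" "j \<le> p"
  shows "total U (segment i j (coarsen U c p \<sigma>)) = total U (segment (c i) (c j) \<sigma>)"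
  using assms
proof (induction j rule: dec_induct)
  case base
  then show ?case
    using c_bound[of i]
    by (simp add: total_segment_refl[OF \<sigma>] total_segment_refl[OF coarsen_simplex])
      (simp add: coarsen_def nth_append)
next
  case (step j)
  have "edge (coarsen U c p \<sigma>) ! j = total U (segment (c j) (c (Suc j)) \<sigma>)"
    using step by (simp add: coarsen_def)
  then show ?case
    using step total_segment_append[OF \<sigma>, of "c i" "c j" "c (Suc j)"]
      c_mono[of i j] c_step[of j] c_bound[of "Suc j"]
    by (simp add: total_segment_Suc[OF coarsen_simplex])
qed

text \<open>Since a coarsening that keeps both ends does not change the composite, a cochain evaluated at
  the coarsened simplex takes its value in the coefficient module of the original one.\<close>

lemma total_coarsen:
  assumes "c 0 = 0" "c p = n"
  shows "total U (coarsen U c p \<sigma>) = total U \<sigma>"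
    "hd (vert (coarsen U c p \<sigma>)) = hd (vert \<sigma>)" "last (vert (coarsen U c p \<sigma>)) = last (vert \<sigma>)"
proof -
  show "total U (coarsen U c p \<sigma>) = total U \<sigma>"
    using total_segment_coarsen[of 0 p] assms
    by (simp add: segment_all[OF coarsen_simplex] segment_all[OF \<sigma>])
  show "hd (vert (coarsen U c p \<sigma>)) = hd (vert \<sigma>)" "last (vert (coarsen U c p \<sigma>)) = last (vert \<sigma>)"
    using assms
    by (simp_all add: simplex_ends[OF \<sigma>] simplex_ends[OF coarsen_simplex])
      (auto simp: coarsen_def nth_append)
qed

end

text \<open>Omitting the inner vertex \<open>j\<close> is the coarsening along the increasing map that skips \<open>j\<close>; this
  transfers everything known about coarsenings to faces.\<close>

lemma face_eq_coarsen:
  assumes \<sigma>: "\<sigma> \<in> simplices U a (Suc n)" and j: "1 \<le> j" "j \<le> n"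
  shows "face U j \<sigma> = coarsen U (\<lambda>s. if s < j then s else Suc s) n \<sigma>"
proof -
  note l = simplex_lengths[OF \<sigma>]
  have e: "total U (segment (j - 1) (Suc j) \<sigma>) = ccomp U (edge \<sigma> ! j) (edge \<sigma> ! (j - 1))"
    using total_segment_Suc[OF \<sigma>, of "j - 1" j] total_segment_edge[OF \<sigma>, of "j - 1"] j by simp
  have e': "total U (segment i (Suc i) \<sigma>) = edge \<sigma> ! i" if "i < Suc n" for i
    using total_segment_edge[OF \<sigma>] that by simp
  show ?thesis
    unfolding face_def coarsen_def simplex.simps
  proof (intro conjI simplex.equality; simp only: simplex.simps)
    show "take j (base \<sigma>) @ drop (Suc j) (base \<sigma>) = map (\<lambda>s. base \<sigma> ! (if s < j then s else Suc s)) [0..<Suc n]"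
      "take j (vert \<sigma>) @ drop (Suc j) (vert \<sigma>) = map (\<lambda>s. vert \<sigma> ! (if s < j then s else Suc s)) [0..<Suc n]"
      using l j by (auto intro!: nth_equalityI simp: nth_append simp del: upt_Suc)
    show "take (j - 1) (edge \<sigma>) @ ccomp U (edge \<sigma> ! j) (edge \<sigma> ! (j - 1)) # drop (Suc j) (edge \<sigma>) =
        map (\<lambda>s. total U (segment (if s < j then s else Suc s) (if Suc s < j then Suc s else Suc (Suc s)) \<sigma>)) [0..<n]"
    proof (rule nth_equalityI)
      fix t assume "t < length (take (j - 1) (edge \<sigma>) @ ccomp U (edge \<sigma> ! j) (edge \<sigma> ! (j - 1)) # drop (Suc j) (edge \<sigma>))"
      then have t: "t < n" using l j by simp
      consider "Suc t < j" | "Suc t = j" | "j \<le> t" by linarith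
      then show "(take (j - 1) (edge \<sigma>) @ ccomp U (edge \<sigma> ! j) (edge \<sigma> ! (j - 1)) # drop (Suc j) (edge \<sigma>)) ! t =
        map (\<lambda>s. total U (segment (if s < j then s else Suc s) (if Suc s < j then Suc s else Suc (Suc s)) \<sigma>)) [0..<n] ! t"
        using t l j e by cases (auto simp: nth_append e' nth_Cons')
    qed (use l j in simp)
  qed
qed

lemma face_simplex:
  assumes "\<sigma> \<in> simplices U a (Suc n)" "1 \<le> j" "j \<le> n"
  shows "face U j \<sigma> \<in> simplices U a n"
  using assms by (simp add: face_eq_coarsen coarsen_simplex)

lemma total_face:
  assumes "\<sigma> \<in> simplices U a (Suc n)" "1 \<le> j" "j \<le> n"
  shows "total U (face U j \<sigma>) = total U \<sigma>"
    "hd (vert (face U j \<sigma>)) = hd (vert \<sigma>)" "last (vert (face U j \<sigma>)) = last (vert \<sigma>)"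
  using assms by (simp_all add: face_eq_coarsen total_coarsen)

lemma mcomp_closed:
  assumes "u \<in> Arr U" "v \<in> Arr U" "tgt U u = src U v"
    "A \<in> obs a (src U u)" "A' \<in> obs a (tgt U u)" "A'' \<in> obs a (tgt U v)"
    "g \<in> carrier (Mor a v A' A'')" "f \<in> carrier (Mor a u A A')"
  shows "mcomp a v u A A' A'' g f \<in> carrier (Mor a (ccomp U v u) A A'')"
  using mcomp_bilinear[OF assms(1-6)] assms(7,8) by (auto simp: bilinear_map_def dest: linear_map.closed)

text \<open>Away from position \<open>j - 1\<close> the arguments are merely reindexed; at that position the composite of two
  arguments lies in the module over the composed edge.\<close>

lemma merge_closed:
  assumes \<sigma>: "\<sigma> \<in> simplices U a (Suc n)" and j: "1 \<le> j" "j \<le> n" and as: "as \<in> args a \<sigma>"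
  shows "merge a j \<sigma> as \<in> args a (face U j \<sigma>)"
proof -
  note l = simplex_lengths[OF \<sigma>]
  have la: "length as = Suc n" using as l by (simp add: args_iff)
  have a: "as ! i \<in> carrier (Mor a (edge \<sigma> ! i) (vert \<sigma> ! i) (vert \<sigma> ! Suc i))" if "i < Suc n" for i
    using as l that by (simp add: args_iff)
  have m: "mcomp a (edge \<sigma> ! j) (edge \<sigma> ! (j - 1)) (vert \<sigma> ! (j - 1)) (vert \<sigma> ! j) (vert \<sigma> ! Suc j)
       (as ! j) (as ! (j - 1)) \<in> carrier (Mor a (ccomp U (edge \<sigma> ! j) (edge \<sigma> ! (j - 1))) (vert \<sigma> ! (j - 1)) (vert \<sigma> ! Suc j))"
    using simplexD[OF \<sigma>, of j] simplexD[OF \<sigma>, of "j - 1"] simplexD(2)[OF \<sigma>, of "Suc j"] j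
      a[of j] a[of "j - 1"]
    by (intro mcomp_closed) simp_all
  show ?thesis
    unfolding args_iff
  proof (intro conjI allI impI)
    show "length (merge a j \<sigma> as) = length (edge (face U j \<sigma>))"
      using l la j by (simp add: merge_def face_def)
    fix t assume "t < length (edge (face U j \<sigma>))"
    then have t: "t < n" using l j by (simp add: face_def)
    consider "Suc t < j" | "Suc t = j" | "j \<le> t" by linarith
    then show "merge a j \<sigma> as ! t \<in> carrier (Mor a (edge (face U j \<sigma>) ! t) (vert (face U j \<sigma>) ! t) (vert (face U j \<sigma>) ! Suc t))"
      using t l la j m a[of t] a[of "Suc t"] by cases (auto simp: merge_def face_def nth_append nth_Cons')
  qed
qed

end

lemma cochain_closed:
  assumes "\<phi> \<in> carrier (cochains k U a M n)" "\<sigma> \<in> simplices U a n" "as \<in> args a \<sigma>"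
  shows "\<phi> \<sigma> as \<in> carrier (coeff U M \<sigma>)"
proof -
  have "\<phi> \<sigma> \<in> carrier (multilinear_maps k (edge_modules a \<sigma>) (coeff U M \<sigma>))"
    using assms by (auto simp: cochains_def product_module_def)
  then show ?thesis using assms(3) by (auto simp: multilinear_maps_def)
qed

lemma coeff_unit_bimodule:
  "coeff U (unit_bimodule a) \<sigma> = Mor a (total U \<sigma>) (hd (vert \<sigma>)) (last (vert \<sigma>))"
  by (simp add: coeff_def unit_bimodule_def)


section \<open>Insertions\<close>

lemma insertionsD:
  assumes "ss \<in> insertions p m"
  shows "length ss = m" "distinct ss" "set ss \<subseteq> {..<p}"
proof -
  have "sorted_wrt (<) (rev ss)" using assms by (simp add: insertions_def sorted_wrt_rev)
  then have "distinct (rev ss)" by (simp only: strict_sorted_iff)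
  then show "distinct ss" by simp
qed (use assms in \<open>auto simp: insertions_def\<close>)

lemma cut_0: "cut qs ss 0 = 0"
  by (simp add: cut_def)

lemma cut_Suc: "cut qs ss (Suc s) = cut qs ss s + (case map_of (zip ss qs) s of None \<Rightarrow> 1 | Some q \<Rightarrow> q)"
  by (simp add: cut_def)

lemma cut_step: "cut qs ss s \<le> cut qs ss (Suc s)"
  by (simp add: cut_Suc)

text \<open>Each of the \<open>length qs\<close> slots receiving an operation consumes \<open>q\<^sub>i\<close> arguments, each of the other
  \<open>p - length qs\<close> slots a single one. Hence the cuts of an insertion form a coarsening that keeps both
  ends of the simplex.\<close>

lemma cut_total:
  assumes ss: "ss \<in> insertions p (length qs)"
  shows "cut qs ss p = p + sum_list qs - length qs"
proof -
  note D = insertionsD[OF ss]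
  let ?f = "\<lambda>t. (case map_of (zip ss qs) t of None \<Rightarrow> 1 | Some q \<Rightarrow> q)"
  have "map ?f ss = qs"
    using D by (auto intro!: nth_equalityI simp: map_of_zip_nth)
  then have "sum ?f (set ss) = sum_list qs"
    using D(2) by (metis sum_list_distinct_conv_sum_set)
  moreover have "sum ?f ({..<p} - set ss) = p - length qs"
  proof -
    have "?f t = 1" if "t \<notin> set ss" for t
      using that D(1) by (auto split: option.splits dest!: map_of_SomeD in_set_zipE)
    then have "sum ?f ({..<p} - set ss) = card ({..<p} - set ss)" by simp
    also have "\<dots> = p - length qs" using D by (simp add: card_Diff_subset distinct_card)
    finally show ?thesis .
  qed
  moreover have "length qs \<le> p"
    using D card_mono[OF finite_lessThan D(3)] by (simp add: distinct_card)
  ultimately show ?thesis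
    using sum.subset_diff[OF D(3), of ?f] by (simp add: cut_def)
qed

text \<open>The dichotomy behind all arguments about insertions: a slot passes on one argument, or it receives
  the \<open>i\<close>-th operation and consumes a block of length \<open>q\<^sub>i\<close>. Two lists of operations are allowed at once,
  since operations on both sides of a functor are to be compared slot by slot.\<close>

lemma slot_cases:
  fixes xs :: "'a list" and ys :: "'b list"
  assumes ss: "ss \<in> insertions p (length qs)" and l: "length xs = length qs" "length ys = length qs"
  obtains "map_of (zip ss xs) s = None" "map_of (zip ss ys) s = None"
      "cut qs ss (Suc s) = Suc (cut qs ss s)"
    | i where "i < length qs" "map_of (zip ss xs) s = Some (xs ! i)" "map_of (zip ss ys) s = Some (ys ! i)"
      "cut qs ss (Suc s) = cut qs ss s + qs ! i"
proof (cases "s \<in> set ss")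
  case False
  then have "map_of (zip ss xs) s = None" "map_of (zip ss ys) s = None" "map_of (zip ss qs) s = None"
    using insertionsD(1)[OF ss] l by (simp_all add: map_of_zip_is_None)
  then show ?thesis using that(1) by (simp add: cut_Suc)
next
  case True
  then obtain i where i: "i < length ss" "s = ss ! i" by (metis in_set_conv_nth)
  then have "map_of (zip ss xs) s = Some (xs ! i)" "map_of (zip ss ys) s = Some (ys ! i)"
    "map_of (zip ss qs) s = Some (qs ! i)"
    using insertionsD(1,2)[OF ss] l by (simp_all add: map_of_zip_nth)
  then show ?thesis using that(2)[of i] i insertionsD(1)[OF ss] by (simp add: cut_Suc)
qed


section \<open>Graded functors on simplices\<close>

context graded_functor
begin

lemma map_simplex_nth:
  assumes "\<sigma> \<in> simplices V b n"
  shows "i \<le> n \<Longrightarrow> base (map_simplex F \<sigma>) ! i = fob F (base \<sigma> ! i)"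
    "i < n \<Longrightarrow> edge (map_simplex F \<sigma>) ! i = farr F (edge \<sigma> ! i)"
    "i \<le> n \<Longrightarrow> vert (map_simplex F \<sigma>) ! i = Fob F (base \<sigma> ! i) (vert \<sigma> ! i)"
  using simplex_lengths[OF assms] by (simp_all add: map_simplex_def)

lemma map_simplex_simplex:
  assumes \<sigma>: "\<sigma> \<in> simplices V b n"
  shows "map_simplex F \<sigma> \<in> simplices U a n"
  using simplexD[OF \<sigma>] simplex_lengths[OF \<sigma>]
  by (auto simp: simplices_def map_simplex_nth[OF \<sigma>] fob_closed Fob_closed farr_closed src_farr tgt_farr)
    (simp_all add: map_simplex_def)

lemma map_simplex_segment: "map_simplex F (segment i j \<sigma>) = segment i j (map_simplex F \<sigma>)"
  by (simp add: map_simplex_def segment_def take_map drop_map take_zip drop_zip)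

text \<open>Functoriality on the base, iterated along a path. The case \<open>i = j\<close> uses that identities are preserved.\<close>

lemma total_segment_map_simplex:
  assumes \<sigma>: "\<sigma> \<in> simplices V b n" and ij: "i \<le> j" "j \<le> n"
  shows "total U (segment i j (map_simplex F \<sigma>)) = farr F (total V (segment i j \<sigma>))"
  using ij
proof (induction j rule: dec_induct)
  case base
  then show ?case
    using simplexD[OF \<sigma>]
    by (simp add: dom.total_segment_refl[OF \<sigma>] cod.total_segment_refl[OF map_simplex_simplex[OF \<sigma>]]
        map_simplex_nth[OF \<sigma>] farr_ident)
next
  case (step j)
  then show ?case
    using simplexD[OF \<sigma>, of j] dom.total_segment[OF \<sigma>, of i j]
    by (simp add: dom.total_segment_Suc[OF \<sigma>] cod.total_segment_Suc[OF map_simplex_simplex[OF \<sigma>]]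
        map_simplex_nth[OF \<sigma>] farr_comp)
qed

lemma total_map_simplex:
  assumes \<sigma>: "\<sigma> \<in> simplices V b n"
  shows "total U (map_simplex F \<sigma>) = farr F (total V \<sigma>)"
  using total_segment_map_simplex[OF \<sigma>, of 0 n]
  by (simp add: segment_all[OF \<sigma>] segment_all[OF map_simplex_simplex[OF \<sigma>]])

lemma map_simplex_ends:
  assumes \<sigma>: "\<sigma> \<in> simplices V b n"
  shows "hd (vert (map_simplex F \<sigma>)) = Fob F (src V (total V \<sigma>)) (hd (vert \<sigma>))"
    "last (vert (map_simplex F \<sigma>)) = Fob F (tgt V (total V \<sigma>)) (last (vert \<sigma>))"
  by (simp_all add: simplex_ends[OF \<sigma>] simplex_ends[OF map_simplex_simplex[OF \<sigma>]] map_simplex_nth[OF \<sigma>]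
      dom.total_closed[OF \<sigma>])

text \<open>This identity of modules is what makes pulling back possible: the values of a cochain on the image
  simplex already lie in the coefficients prescribed by the pulled back bimodule.\<close>

lemma coeff_map_simplex:
  assumes \<sigma>: "\<sigma> \<in> simplices V b n"
  shows "coeff U M (map_simplex F \<sigma>) = coeff V (pullback_bimodule V F M) \<sigma>"
  by (simp add: coeff_def pullback_bimodule_def total_map_simplex[OF \<sigma>] map_simplex_ends[OF \<sigma>])

text \<open>A functor preserves composites of blocks of edges, so it commutes with every coarsening. The
  compatibility with faces and with the contractions of a brace is a special case.\<close>

lemma map_simplex_coarsen:
  assumes \<sigma>: "\<sigma> \<in> simplices V b n" and c: "\<And>s. s < p \<Longrightarrow> c s \<le> c (Suc s)" "c p \<le> n"
  shows "map_simplex F (coarsen V c p \<sigma>) = coarsen U c p (map_simplex F \<sigma>)"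
proof -
  have b: "c s \<le> n" if "s \<le> p" for s
    using that c by (induction s rule: inc_induct) (auto intro: order_trans)
  define \<tau> where "\<tau> = map_simplex F \<sigma>"
  have \<tau>: "base \<tau> ! i = fob F (base \<sigma> ! i)" "vert \<tau> ! i = Fob F (base \<sigma> ! i) (vert \<sigma> ! i)" if "i \<le> n" for i
    using map_simplex_nth[OF \<sigma>] that by (simp_all add: \<tau>_def)
  have t: "total U (segment i j \<tau>) = farr F (total V (segment i j \<sigma>))" if "i \<le> j" "j \<le> n" for i j
    using total_segment_map_simplex[OF \<sigma>] that by (simp add: \<tau>_def)
  show ?thesis
    unfolding \<tau>_def[symmetric] using b c(1)
    by (auto intro!: nth_equalityI simp: map_simplex_def coarsen_def \<tau> t less_Suc_eq_le simp del: upt_Suc)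
qed

lemma map_simplex_face:
  assumes \<sigma>: "\<sigma> \<in> simplices V b (Suc n)" and "1 \<le> j" "j \<le> n"
  shows "map_simplex F (face V j \<sigma>) = face U j (map_simplex F \<sigma>)"
  unfolding dom.face_eq_coarsen[OF assms] cod.face_eq_coarsen[OF map_simplex_simplex[OF \<sigma>] assms(2,3)]
  by (rule map_simplex_coarsen[OF \<sigma>]) (use assms in auto)

lemma map_args_nth:
  assumes "\<sigma> \<in> simplices V b n" "i < n"
  shows "map_args F \<sigma> as ! i = Fmor F (edge \<sigma> ! i) (vert \<sigma> ! i) (vert \<sigma> ! Suc i) (as ! i)"
  using assms simplex_lengths[OF assms(1)] by (simp add: map_args_def)

lemma length_map_args: "length (map_args F \<sigma> as) = length (edge \<sigma>)"
  by (simp add: map_args_def)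

lemma Fmor_edge_linear:
  assumes \<sigma>: "\<sigma> \<in> simplices V b n" and i: "i < n"
  shows "linear_map k (Mor b (edge \<sigma> ! i) (vert \<sigma> ! i) (vert \<sigma> ! Suc i))
    (Mor a (edge (map_simplex F \<sigma>) ! i) (vert (map_simplex F \<sigma>) ! i) (vert (map_simplex F \<sigma>) ! Suc i))
    (Fmor F (edge \<sigma> ! i) (vert \<sigma> ! i) (vert \<sigma> ! Suc i))"
  using Fmor_linear[of "edge \<sigma> ! i" "vert \<sigma> ! i" "vert \<sigma> ! Suc i"] simplexD[OF \<sigma>, of i]
    simplexD(2)[OF \<sigma>, of "Suc i"] i
  by (simp add: map_simplex_nth[OF \<sigma>])

lemma map_args_closed:
  assumes \<sigma>: "\<sigma> \<in> simplices V b n" and as: "as \<in> args b \<sigma>"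
  shows "map_args F \<sigma> as \<in> args a (map_simplex F \<sigma>)"
  using as linear_map.closed[OF Fmor_edge_linear[OF \<sigma>]] simplex_lengths[OF \<sigma>]
    simplex_lengths[OF map_simplex_simplex[OF \<sigma>]]
  by (simp add: args_iff length_map_args map_args_nth[OF \<sigma>])

lemma map_args_update:
  assumes \<sigma>: "\<sigma> \<in> simplices V b n" and as: "as \<in> args b \<sigma>" and i: "i < n"
  shows "map_args F \<sigma> (as[i := x]) =
    (map_args F \<sigma> as)[i := Fmor F (edge \<sigma> ! i) (vert \<sigma> ! i) (vert \<sigma> ! Suc i) x]"
  using as i simplex_lengths[OF \<sigma>]
  by (intro nth_equalityI) (auto simp: args_iff length_map_args map_args_nth[OF \<sigma>] nth_list_update)

lemma map_args_segment:
  assumes \<sigma>: "\<sigma> \<in> simplices V b n" and ij: "i \<le> j" "j \<le> n" and as: "as \<in> args b \<sigma>"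
  shows "map_args F (segment i j \<sigma>) (seg_args i j as) = seg_args i j (map_args F \<sigma> as)"
  using as ij simplex_lengths[OF \<sigma>] segment_lengths[OF \<sigma> ij]
  by (intro nth_equalityI) (auto simp: length_map_args map_args_nth[OF segment_simplex[OF \<sigma> ij]]
      map_args_nth[OF \<sigma>] segment_nth[OF \<sigma> ij] seg_args_def args_iff)

text \<open>At the merged position this is the multiplicativity of \<open>F\<close>; elsewhere both sides apply \<open>F\<close> to the same
  argument.\<close>

lemma map_args_merge:
  assumes \<sigma>: "\<sigma> \<in> simplices V b (Suc n)" and j: "1 \<le> j" "j \<le> n" and as: "as \<in> args b \<sigma>"
  shows "map_args F (face V j \<sigma>) (merge b j \<sigma> as) = merge a j (map_simplex F \<sigma>) (map_args F \<sigma> as)"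
proof -
  note l = simplex_lengths[OF \<sigma>] and f = dom.face_simplex[OF \<sigma> j]
  have la: "length as = Suc n" using as l by (simp add: args_iff)
  have mem: "as ! i \<in> carrier (Mor b (edge \<sigma> ! i) (vert \<sigma> ! i) (vert \<sigma> ! Suc i))" if "i < Suc n" for i
    using as l that by (simp add: args_iff)
  have m: "Fmor F (ccomp V (edge \<sigma> ! j) (edge \<sigma> ! (j - 1))) (vert \<sigma> ! (j - 1)) (vert \<sigma> ! Suc j)
      (mcomp b (edge \<sigma> ! j) (edge \<sigma> ! (j - 1)) (vert \<sigma> ! (j - 1)) (vert \<sigma> ! j) (vert \<sigma> ! Suc j) (as ! j) (as ! (j - 1))) =
    mcomp a (edge (map_simplex F \<sigma>) ! j) (edge (map_simplex F \<sigma>) ! (j - 1)) (vert (map_simplex F \<sigma>) ! (j - 1))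
      (vert (map_simplex F \<sigma>) ! j) (vert (map_simplex F \<sigma>) ! Suc j) (map_args F \<sigma> as ! j) (map_args F \<sigma> as ! (j - 1))"
    using simplexD[OF \<sigma>, of j] simplexD[OF \<sigma>, of "j - 1"] simplexD(2)[OF \<sigma>, of "Suc j"] j mem[of j] mem[of "j - 1"]
    by (simp add: map_simplex_nth[OF \<sigma>] map_args_nth[OF \<sigma>] Fmor_comp)
  show ?thesis
  proof (rule nth_equalityI)
    show "length (map_args F (face V j \<sigma>) (merge b j \<sigma> as)) = length (merge a j (map_simplex F \<sigma>) (map_args F \<sigma> as))"
      using l j by (simp add: length_map_args face_def merge_def)
    fix t assume "t < length (map_args F (face V j \<sigma>) (merge b j \<sigma> as))"
    then have t: "t < n" using simplex_lengths[OF f] by (simp add: length_map_args)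
    consider "Suc t < j" | "Suc t = j" | "j \<le> t" by linarith
    then show "map_args F (face V j \<sigma>) (merge b j \<sigma> as) ! t = merge a j (map_simplex F \<sigma>) (map_args F \<sigma> as) ! t"
      using t l la j m unfolding map_args_nth[OF f t]
      by cases (auto simp: map_args_nth[OF \<sigma>] merge_def face_def nth_append nth_Cons'
          length_map_args)
  qed
qed

end


section \<open>Bimodules and modules of cochains\<close>

lemma bilinear_map_closed:
  "\<lbrakk>bilinear_map k L M N f; x \<in> carrier L; y \<in> carrier M\<rbrakk> \<Longrightarrow> f x y \<in> carrier N"
  by (auto simp: bilinear_map_def dest: linear_map.closed)

lemma bilinear_map_comp:
  assumes "bilinear_map k L M N f"
  shows "linear_map k L' L g \<Longrightarrow> bilinear_map k L' M N (\<lambda>x y. f (g x) y)"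
    and "linear_map k M' M h \<Longrightarrow> bilinear_map k L M' N (\<lambda>x y. f x (h y))"
proof -
  have f: "\<And>x. x \<in> carrier L \<Longrightarrow> linear_map k M N (\<lambda>y. f x y)"
    "\<And>y. y \<in> carrier M \<Longrightarrow> linear_map k L N (\<lambda>x. f x y)"
    using assms by (simp_all add: bilinear_map_def)
  show "bilinear_map k L' M N (\<lambda>x y. f (g x) y)" if g: "linear_map k L' L g"
    unfolding bilinear_map_def
    by (intro conjI ballI f(1) linear_map.closed[OF g] linear_map_comp[OF g f(2)])
  show "bilinear_map k L M' N (\<lambda>x y. f x (h y))" if h: "linear_map k M' M h"
    unfolding bilinear_map_def
    by (intro conjI ballI f(2) linear_map.closed[OF h] linear_map_comp[OF h f(1)])
qed

lemma (in graded_category) unit_bimodule_bimodule: "bimodule k U a (unit_bimodule a)"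
  by (intro bimodule.intro bimodule_axioms.intro graded_category_axioms; unfold unit_bimodule_def bimod.simps)
    (erule (2) Mor_module, erule (5) mcomp_bilinear, erule (5) mcomp_bilinear, erule (11) mcomp_assoc,
      erule (11) mcomp_assoc, erule (11) mcomp_assoc, erule (3) unit_left, erule (3) unit_right)

text \<open>Each axiom for the pullback is the same axiom for \<open>M\<close> at the image data, after rewriting \<open>F\<close> of a
  composite or of an identity.\<close>

lemma (in graded_functor) pullback_bimodule_bimodule:
  assumes "bimodule k U a M"
  shows "bimodule k V b (pullback_bimodule V F M)"
proof -
  interpret M: bimodule k U a M by fact
  note F = farr_closed src_farr tgt_farr Fob_closed dom.src_closed dom.tgt_closed dom.src_comp dom.tgt_comp
    farr_comp dom.comp_arr linear_map.closed[OF Fmor_linear]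
  show ?thesis
  proof (intro bimodule.intro bimodule_axioms.intro dom.graded_category_axioms;
      unfold pullback_bimodule_def bimod.simps)
    fix v w B B' B''
    assume A: "v \<in> Arr V" "w \<in> Arr V" "tgt V v = src V w"
      "B \<in> obs b (src V v)" "B' \<in> obs b (tgt V v)" "B'' \<in> obs b (tgt V w)"
    have l: "bilinear_map k (Mor a (farr F w) (Fob F (tgt V v) B') (Fob F (tgt V w) B''))
      (Bm M (farr F v) (Fob F (src V v) B) (Fob F (tgt V v) B'))
      (Bm M (ccomp U (farr F w) (farr F v)) (Fob F (src V v) B) (Fob F (tgt V w) B''))
      (lact M (farr F w) (farr F v) (Fob F (src V v) B) (Fob F (tgt V v) B') (Fob F (tgt V w) B''))"
      by (rule M.lact_bilinear) (use A in \<open>simp_all add: F\<close>)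
    have r: "bilinear_map k (Bm M (farr F w) (Fob F (tgt V v) B') (Fob F (tgt V w) B''))
      (Mor a (farr F v) (Fob F (src V v) B) (Fob F (tgt V v) B'))
      (Bm M (ccomp U (farr F w) (farr F v)) (Fob F (src V v) B) (Fob F (tgt V w) B''))
      (ract M (farr F w) (farr F v) (Fob F (src V v) B) (Fob F (tgt V v) B') (Fob F (tgt V w) B''))"
      by (rule M.ract_bilinear) (use A in \<open>simp_all add: F\<close>)
    have Fw: "linear_map k (Mor b w B' B'') (Mor a (farr F w) (Fob F (tgt V v) B') (Fob F (tgt V w) B'')) (Fmor F w B' B'')"
      using Fmor_linear[of w B' B''] A by simp
    have Fv: "linear_map k (Mor b v B B') (Mor a (farr F v) (Fob F (src V v) B) (Fob F (tgt V v) B')) (Fmor F v B B')"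
      using Fmor_linear[of v B B'] A by simp
    show "bilinear_map k (Mor b w B' B'') (Bm M (farr F v) (Fob F (src V v) B) (Fob F (tgt V v) B'))
      (Bm M (farr F (ccomp V w v)) (Fob F (src V (ccomp V w v)) B) (Fob F (tgt V (ccomp V w v)) B''))
      (\<lambda>g m. lact M (farr F w) (farr F v) (Fob F (src V v) B) (Fob F (tgt V v) B') (Fob F (tgt V w) B'')
        (Fmor F w B' B'' g) m)"
      using bilinear_map_comp(1)[OF l Fw] A by (simp add: F)
    show "bilinear_map k (Bm M (farr F w) (Fob F (src V w) B') (Fob F (tgt V w) B'')) (Mor b v B B')
      (Bm M (farr F (ccomp V w v)) (Fob F (src V (ccomp V w v)) B) (Fob F (tgt V (ccomp V w v)) B''))
      (\<lambda>m f. ract M (farr F w) (farr F v) (Fob F (src V v) B) (Fob F (tgt V v) B') (Fob F (tgt V w) B'')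
        m (Fmor F v B B' f))"
      using bilinear_map_comp(2)[OF r Fv] A by (simp add: F)
  next
    fix v A A' assume "v \<in> Arr V" "A \<in> obs b (src V v)" "A' \<in> obs b (tgt V v)"
    then show "module k (Bm M (farr F v) (Fob F (src V v) A) (Fob F (tgt V v) A'))"
      by (simp add: F M.Bm_module)
  next
    fix u v w A A' A'' A''' m g h
    assume A: "u \<in> Arr V" "v \<in> Arr V" "w \<in> Arr V" "tgt V u = src V v" "tgt V v = src V w"
      "A \<in> obs b (src V u)" "A' \<in> obs b (tgt V u)" "A'' \<in> obs b (tgt V v)" "A''' \<in> obs b (tgt V w)"
    { assume B: "m \<in> carrier (Bm M (farr F u) (Fob F (src V u) A) (Fob F (tgt V u) A'))"
        "g \<in> carrier (Mor b v A' A'')" "h \<in> carrier (Mor b w A'' A''')"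
      show "lact M (farr F (ccomp V w v)) (farr F u) (Fob F (src V u) A) (Fob F (tgt V u) A')
          (Fob F (tgt V (ccomp V w v)) A''') (Fmor F (ccomp V w v) A' A''' (mcomp b w v A' A'' A''' h g)) m =
        lact M (farr F w) (farr F (ccomp V v u)) (Fob F (src V (ccomp V v u)) A) (Fob F (tgt V (ccomp V v u)) A'')
          (Fob F (tgt V w) A''') (Fmor F w A'' A''' h)
          (lact M (farr F v) (farr F u) (Fob F (src V u) A) (Fob F (tgt V u) A') (Fob F (tgt V v) A'')
            (Fmor F v A' A'' g) m)"
        using A B linear_map.closed[OF Fmor_linear, of v A' A'' g] linear_map.closed[OF Fmor_linear, of w A'' A''' h]
        by (simp add: F Fmor_comp M.lact_assoc) }
    { assume B: "m \<in> carrier (Mor b u A A')" "g \<in> carrier (Mor b v A' A'')"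
        "h \<in> carrier (Bm M (farr F w) (Fob F (src V w) A'') (Fob F (tgt V w) A'''))"
      show "ract M (farr F (ccomp V w v)) (farr F u) (Fob F (src V u) A) (Fob F (tgt V u) A')
          (Fob F (tgt V (ccomp V w v)) A''') (ract M (farr F w) (farr F v) (Fob F (src V v) A') (Fob F (tgt V v) A'')
            (Fob F (tgt V w) A''') h (Fmor F v A' A'' g)) (Fmor F u A A' m) =
        ract M (farr F w) (farr F (ccomp V v u)) (Fob F (src V (ccomp V v u)) A) (Fob F (tgt V (ccomp V v u)) A'')
          (Fob F (tgt V w) A''') h (Fmor F (ccomp V v u) A A'' (mcomp b v u A A' A'' g m))"
        using A B linear_map.closed[OF Fmor_linear, of v A' A'' g] linear_map.closed[OF Fmor_linear, of u A A' m]
        by (simp add: F Fmor_comp M.ract_assoc) }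
    { assume B: "m \<in> carrier (Mor b u A A')" "g \<in> carrier (Bm M (farr F v) (Fob F (src V v) A') (Fob F (tgt V v) A''))"
        "h \<in> carrier (Mor b w A'' A''')"
      show "ract M (farr F (ccomp V w v)) (farr F u) (Fob F (src V u) A) (Fob F (tgt V u) A')
          (Fob F (tgt V (ccomp V w v)) A''') (lact M (farr F w) (farr F v) (Fob F (src V v) A') (Fob F (tgt V v) A'')
            (Fob F (tgt V w) A''') (Fmor F w A'' A''' h) g) (Fmor F u A A' m) =
        lact M (farr F w) (farr F (ccomp V v u)) (Fob F (src V (ccomp V v u)) A) (Fob F (tgt V (ccomp V v u)) A'')
          (Fob F (tgt V w) A''') (Fmor F w A'' A''' h)
          (ract M (farr F v) (farr F u) (Fob F (src V u) A) (Fob F (tgt V u) A') (Fob F (tgt V v) A'') g (Fmor F u A A' m))"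
        using A B linear_map.closed[OF Fmor_linear, of w A'' A''' h] linear_map.closed[OF Fmor_linear, of u A A' m]
        by (simp add: F M.lact_ract) }
  next
    fix u A A' m
    assume A: "u \<in> Arr V" "A \<in> obs b (src V u)" "A' \<in> obs b (tgt V u)"
      "m \<in> carrier (Bm M (farr F u) (Fob F (src V u) A) (Fob F (tgt V u) A'))"
    then show "lact M (farr F (ident V (tgt V u))) (farr F u) (Fob F (src V u) A) (Fob F (tgt V u) A')
        (Fob F (tgt V (ident V (tgt V u))) A') (Fmor F (ident V (tgt V u)) A' A' (unit b (tgt V u) A')) m = m"
      "ract M (farr F u) (farr F (ident V (src V u))) (Fob F (src V (ident V (src V u))) A)
        (Fob F (tgt V (ident V (src V u))) A) (Fob F (tgt V u) A') m
        (Fmor F (ident V (src V u)) A A (unit b (src V u) A)) = m"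
      using M.lact_unit[of "farr F u" "Fob F (src V u) A" "Fob F (tgt V u) A'" m]
        M.ract_unit[of "farr F u" "Fob F (src V u) A" "Fob F (tgt V u) A'" m]
      by (simp_all add: F Fmor_unit farr_ident dom.src_ident dom.tgt_ident)
  qed
qed

lemma (in graded_category) edge_module:
  assumes "\<sigma> \<in> simplices U a n" "i < length (edge_modules a \<sigma>)"
  shows "module k (edge_modules a \<sigma> ! i)"
proof -
  have "i < n" using assms by (simp add: edge_modules_def simplex_lengths)
  then show ?thesis
    using assms(2) simplexD[OF assms(1), of i] simplexD(2)[OF assms(1), of "Suc i"]
    by (simp add: edge_modules_def Mor_module)
qed

context bimodule
begin

lemma coeff_module: "\<sigma> \<in> simplices U a n \<Longrightarrow> module k (coeff U M \<sigma>)"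
  using simplexD(2)[of \<sigma> U a n 0] simplexD(2)[of \<sigma> U a n n]
  by (simp add: coeff_def Bm_module simplex_ends total_closed)

lemma cochains_module: "module k (cochains k U a M n)"
  unfolding cochains_def
  by (intro product_moduleI multilinear_maps_moduleI is_cring coeff_module edge_module) auto

context
  fixes n \<sigma> as
  assumes \<sigma>: "\<sigma> \<in> simplices U a (Suc n)" and as: "as \<in> args a \<sigma>"
begin

private lemma arg: "i \<le> n \<Longrightarrow> as ! i \<in> carrier (Mor a (edge \<sigma> ! i) (vert \<sigma> ! i) (vert \<sigma> ! Suc i))"
  using as simplex_lengths[OF \<sigma>] by (simp add: args_iff)

lemma lact_term_closed:
  assumes "m \<in> carrier (coeff U M (segment 0 n \<sigma>))"
  shows "lact M (edge \<sigma> ! n) (total U (segment 0 n \<sigma>)) (vert \<sigma> ! 0) (vert \<sigma> ! n) (vert \<sigma> ! Suc n) (as ! n) m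
    \<in> carrier (coeff U M \<sigma>)"
proof -
  have "total U \<sigma> = ccomp U (edge \<sigma> ! n) (total U (segment 0 n \<sigma>))"
    using total_segment_Suc[OF \<sigma>, of 0 n] by (simp add: segment_all[OF \<sigma>])
  then show ?thesis
    using assms arg[of n] total_segment[OF \<sigma>, of 0 n] simplexD[OF \<sigma>, of n] simplexD(2)[OF \<sigma>, of 0] simplexD(2)[OF \<sigma>, of "Suc n"]
    by (auto simp: coeff_def simplex_ends[OF \<sigma>] segment_ends[OF \<sigma>] intro!: bilinear_map_closed[OF lact_bilinear])
qed

lemma ract_term_closed:
  assumes "m \<in> carrier (coeff U M (segment 1 (Suc n) \<sigma>))"
  shows "ract M (total U (segment 1 (Suc n) \<sigma>)) (edge \<sigma> ! 0) (vert \<sigma> ! 0) (vert \<sigma> ! 1) (vert \<sigma> ! Suc n) m (as ! 0)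
    \<in> carrier (coeff U M \<sigma>)"
proof -
  have "total U \<sigma> = ccomp U (total U (segment 1 (Suc n) \<sigma>)) (edge \<sigma> ! 0)"
    using total_segment_append[OF \<sigma>, of 0 1 "Suc n"] total_segment_edge[OF \<sigma>, of 0] by (simp add: segment_all[OF \<sigma>])
  then show ?thesis
    using assms arg[of 0] total_segment[OF \<sigma>, of 1 "Suc n"] simplexD[OF \<sigma>, of 0] simplexD(2)[OF \<sigma>, of 1] simplexD(2)[OF \<sigma>, of "Suc n"]
    by (auto simp: coeff_def simplex_ends[OF \<sigma>] segment_ends[OF \<sigma>] intro!: bilinear_map_closed[OF ract_bilinear])
qed

lemma face_term_closed:
  assumes \<phi>: "\<phi> \<in> carrier (cochains k U a M n)" and i: "i \<in> {1..n}"
  shows "\<phi> (face U (Suc n - i) \<sigma>) (merge a (Suc n - i) \<sigma> as) \<in> carrier (coeff U M \<sigma>)"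
  using cochain_closed[OF \<phi> face_simplex[OF \<sigma>, of "Suc n - i"] merge_closed[OF \<sigma> _ _ as, of "Suc n - i"]] i
  by (auto simp: coeff_def total_face[OF \<sigma>])

lemma outer_values_closed:
  assumes \<phi>: "\<phi> \<in> carrier (cochains k U a M n)"
  shows "\<phi> (segment 0 n \<sigma>) (seg_args 0 n as) \<in> carrier (coeff U M (segment 0 n \<sigma>))"
    "\<phi> (segment 1 (Suc n) \<sigma>) (seg_args 1 (Suc n) as) \<in> carrier (coeff U M (segment 1 (Suc n) \<sigma>))"
  using segment_simplex[OF \<sigma>, of 0 n] segment_simplex[OF \<sigma>, of 1 "Suc n"]
  by (auto intro!: cochain_closed[OF \<phi>] seg_args_closed[OF \<sigma> _ _ as])

lemma hochschild_d_closed: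
  assumes \<phi>: "\<phi> \<in> carrier (cochains k U a M n)"
  shows "hochschild_d U a M n \<phi> \<sigma> as \<in> carrier (coeff U M \<sigma>)"
proof -
  interpret C: module k "coeff U M \<sigma>" by (rule coeff_module[OF \<sigma>])
  note S = signed_closed[OF C.module_axioms]
  show ?thesis
    using \<sigma> as lact_term_closed[OF outer_values_closed(1)[OF \<phi>]] S[OF ract_term_closed[OF outer_values_closed(2)[OF \<phi>]]]
      S[OF face_term_closed[OF \<phi>]]
    by (simp add: hochschild_d_def C.M.finsum_closed Pi_def)
qed

end

end


section \<open>Pulling back cochains\<close>

lemma cochainsI:
  assumes "\<phi> \<in> extensional (simplices U a n)"
    and "\<And>\<sigma>. \<sigma> \<in> simplices U a n \<Longrightarrow> \<phi> \<sigma> \<in> extensional (args a \<sigma>)"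
    and "\<And>\<sigma> as. \<lbrakk>\<sigma> \<in> simplices U a n; as \<in> args a \<sigma>\<rbrakk> \<Longrightarrow> \<phi> \<sigma> as \<in> carrier (coeff U M \<sigma>)"
    and "\<And>\<sigma> as i. \<lbrakk>\<sigma> \<in> simplices U a n; as \<in> args a \<sigma>; i < n\<rbrakk> \<Longrightarrow>
      linear_map k (Mor a (edge \<sigma> ! i) (vert \<sigma> ! i) (vert \<sigma> ! Suc i)) (coeff U M \<sigma>) (\<lambda>x. \<phi> \<sigma> (as[i := x]))"
  shows "\<phi> \<in> carrier (cochains k U a M n)"
proof -
  have "\<phi> \<sigma> \<in> carrier (multilinear_maps k (edge_modules a \<sigma>) (coeff U M \<sigma>))" if "\<sigma> \<in> simplices U a n" for \<sigma>
    using assms(2-) that by (intro multilinear_mapsI) (auto simp: edge_modules_def simplex_lengths)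
  then show ?thesis using assms(1) by (simp add: cochains_def product_module_def PiE_iff)
qed

lemma cochain_linear:
  assumes "\<phi> \<in> carrier (cochains k U a M n)" "\<sigma> \<in> simplices U a n" "as \<in> args a \<sigma>" "i < n"
  shows "linear_map k (Mor a (edge \<sigma> ! i) (vert \<sigma> ! i) (vert \<sigma> ! Suc i)) (coeff U M \<sigma>) (\<lambda>x. \<phi> \<sigma> (as[i := x]))"
proof -
  have "\<phi> \<sigma> \<in> carrier (multilinear_maps k (edge_modules a \<sigma>) (coeff U M \<sigma>))"
    using assms by (auto simp: cochains_def product_module_def)
  then show ?thesis using assms by (auto simp: multilinear_maps_def edge_modules_def simplex_lengths)
qed

lemma cochain_eqI:
  assumes "\<phi> \<in> carrier (cochains k U a M n)" "\<psi> \<in> carrier (cochains k U a N n)"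
    and "\<And>\<sigma> as. \<lbrakk>\<sigma> \<in> simplices U a n; as \<in> args a \<sigma>\<rbrakk> \<Longrightarrow> \<phi> \<sigma> as = \<psi> \<sigma> as"
  shows "\<phi> = \<psi>"
proof (rule extensionalityI)
  show "\<phi> \<in> extensional (simplices U a n)" "\<psi> \<in> extensional (simplices U a n)"
    using assms(1,2) by (simp_all add: cochains_def product_module_def PiE_iff)
  fix \<sigma> assume \<sigma>: "\<sigma> \<in> simplices U a n"
  show "\<phi> \<sigma> = \<psi> \<sigma>"
  proof (rule extensionalityI)
    show "\<phi> \<sigma> \<in> extensional (args a \<sigma>)" "\<psi> \<sigma> \<in> extensional (args a \<sigma>)"
      using assms(1,2) \<sigma> by (auto simp: cochains_def product_module_def multilinear_maps_def PiE_iff)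
  qed (use assms(3) \<sigma> in simp)
qed

lemma (in bimodule) cochain_eval_linear:
  assumes "\<sigma> \<in> simplices U a n" "as \<in> args a \<sigma>"
  shows "linear_map k (cochains k U a M n) (coeff U M \<sigma>) (\<lambda>\<phi>. \<phi> \<sigma> as)"
  using assms
  by (intro linear_mapI cochains_module coeff_module cochain_closed)
    (simp_all add: cochains_def product_module_def multilinear_maps_def)

text \<open>Operations on cochains are pointwise, so linearity may be tested after evaluation at each simplex
  and each list of arguments.\<close>

lemma linear_map_into_cochainsI:
  assumes N: "bimodule k U a N" and L: "module k L"
    and closed: "\<And>x. x \<in> carrier L \<Longrightarrow> f x \<in> carrier (cochains k U a N n)"
    and lin: "\<And>\<sigma> as. \<lbrakk>\<sigma> \<in> simplices U a n; as \<in> args a \<sigma>\<rbrakk> \<Longrightarrow> linear_map k L (coeff U N \<sigma>) (\<lambda>x. f x \<sigma> as)"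
  shows "linear_map k L (cochains k U a N n) f"
proof -
  interpret N: bimodule k U a N by fact
  interpret L: module k L by fact
  interpret C: module k "cochains k U a N n" by (rule N.cochains_module)
  show ?thesis
  proof (rule linear_mapI[OF L C.module_axioms closed])
    fix x y assume xy: "x \<in> carrier L" "y \<in> carrier L"
    show "f (x \<oplus>\<^bsub>L\<^esub> y) = f x \<oplus>\<^bsub>cochains k U a N n\<^esub> f y"
    proof (rule cochain_eqI[where k=k and M=N and N=N])
      fix \<sigma> as assume s: "\<sigma> \<in> simplices U a n" "as \<in> args a \<sigma>"
      show "f (x \<oplus>\<^bsub>L\<^esub> y) \<sigma> as = (f x \<oplus>\<^bsub>cochains k U a N n\<^esub> f y) \<sigma> as"
        using linear_map.add[OF lin[OF s] xy] linear_map.add[OF N.cochain_eval_linear[OF s]] closed xy by simp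
    qed (use xy closed in simp_all)
  next
    fix c x assume cx: "c \<in> carrier k" "x \<in> carrier L"
    show "f (c \<odot>\<^bsub>L\<^esub> x) = c \<odot>\<^bsub>cochains k U a N n\<^esub> f x"
    proof (rule cochain_eqI[where k=k and M=N and N=N])
      fix \<sigma> as assume s: "\<sigma> \<in> simplices U a n" "as \<in> args a \<sigma>"
      show "f (c \<odot>\<^bsub>L\<^esub> x) \<sigma> as = (c \<odot>\<^bsub>cochains k U a N n\<^esub> f x) \<sigma> as"
        using linear_map.smult[OF lin[OF s] cx] linear_map.smult[OF N.cochain_eval_linear[OF s]] closed cx by simp
    qed (use cx closed in simp_all)
  qed
qed

text \<open>The only point with content is multilinearity of the pullback: changing one argument changes one
  argument of its image, by the linear map \<open>F\<close>.\<close>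

lemma (in graded_functor) pullback_cochain_linear:
  assumes "bimodule k U a M"
  shows "linear_map k (cochains k U a M n) (cochains k V b (pullback_bimodule V F M) n) (pullback_cochain V b F n)"
proof -
  interpret M: bimodule k U a M by fact
  let ?N = "pullback_bimodule V F M"
  show ?thesis
  proof (rule linear_map_into_cochainsI[OF pullback_bimodule_bimodule[OF assms] M.cochains_module])
    fix \<sigma> as assume s: "\<sigma> \<in> simplices V b n" "as \<in> args b \<sigma>"
    show "linear_map k (cochains k U a M n) (coeff V ?N \<sigma>) (\<lambda>\<phi>. pullback_cochain V b F n \<phi> \<sigma> as)"
      using M.cochain_eval_linear[OF map_simplex_simplex[OF s(1)] map_args_closed[OF s]] s
      by (simp add: pullback_cochain_def coeff_map_simplex)
  next
    fix \<phi> assume \<phi>: "\<phi> \<in> carrier (cochains k U a M n)"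
    show "pullback_cochain V b F n \<phi> \<in> carrier (cochains k V b ?N n)"
    proof (rule cochainsI)
      fix \<sigma> as assume s: "\<sigma> \<in> simplices V b n" "as \<in> args b \<sigma>"
      show "pullback_cochain V b F n \<phi> \<sigma> as \<in> carrier (coeff V ?N \<sigma>)"
        using cochain_closed[OF \<phi> map_simplex_simplex[OF s(1)] map_args_closed[OF s]] s
        by (simp add: pullback_cochain_def coeff_map_simplex)
      fix i assume i: "i < n"
      let ?X = "Mor b (edge \<sigma> ! i) (vert \<sigma> ! i) (vert \<sigma> ! Suc i)"
      have "linear_map k ?X (coeff V ?N \<sigma>) (\<lambda>x. \<phi> (map_simplex F \<sigma>) (map_args F \<sigma> (as[i := x])))"
        using linear_map_comp[OF Fmor_edge_linear[OF s(1) i]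
            cochain_linear[OF \<phi> map_simplex_simplex[OF s(1)] map_args_closed[OF s] i]] s
        by (simp add: map_args_update[OF s i] coeff_map_simplex)
      moreover have "as[i := x] \<in> args b \<sigma>" if "x \<in> carrier ?X" for x
        using tuples_update[OF s(2), of x i] that i s(1) by (simp add: edge_modules_def simplex_lengths)
      ultimately show "linear_map k ?X (coeff V ?N \<sigma>) (\<lambda>x. pullback_cochain V b F n \<phi> \<sigma> (as[i := x]))"
        using s(1) by (elim linear_map_cong) (simp add: pullback_cochain_def)
    qed (simp_all add: pullback_cochain_def)
  qed
qed

lemma coeff_map_linear:
  assumes "bimodule k U a M" "bimodule k U a N"
    and h: "\<And>u A A'. \<lbrakk>u \<in> Arr U; A \<in> obs a (src U u); A' \<in> obs a (tgt U u)\<rbrakk>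
      \<Longrightarrow> linear_map k (Bm M u A A') (Bm N u A A') (h u A A')"
  shows "linear_map k (cochains k U a M n) (cochains k U a N n) (coeff_map U a h n)"
proof -
  interpret M: bimodule k U a M by fact
  interpret N: bimodule k U a N by fact
  have hc: "linear_map k (coeff U M \<sigma>) (coeff U N \<sigma>) (h (total U \<sigma>) (hd (vert \<sigma>)) (last (vert \<sigma>)))"
    if "\<sigma> \<in> simplices U a n" for \<sigma>
    using that simplexD(2)[OF that, of 0] simplexD(2)[OF that, of n]
    by (simp add: coeff_def h simplex_ends M.total_closed)
  show ?thesis
  proof (rule linear_map_into_cochainsI[OF assms(2) M.cochains_module])
    fix \<sigma> as assume s: "\<sigma> \<in> simplices U a n" "as \<in> args a \<sigma>"
    show "linear_map k (cochains k U a M n) (coeff U N \<sigma>) (\<lambda>\<phi>. coeff_map U a h n \<phi> \<sigma> as)"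
      using linear_map_comp[OF M.cochain_eval_linear[OF s] hc[OF s(1)]] s by (simp add: coeff_map_def)
  next
    fix \<phi> assume \<phi>: "\<phi> \<in> carrier (cochains k U a M n)"
    show "coeff_map U a h n \<phi> \<in> carrier (cochains k U a N n)"
    proof (rule cochainsI)
      fix \<sigma> as assume s: "\<sigma> \<in> simplices U a n" "as \<in> args a \<sigma>"
      show "coeff_map U a h n \<phi> \<sigma> as \<in> carrier (coeff U N \<sigma>)"
        using linear_map.closed[OF hc[OF s(1)] cochain_closed[OF \<phi> s]] s by (simp add: coeff_map_def)
      fix i assume i: "i < n"
      have "as[i := x] \<in> args a \<sigma>" if "x \<in> carrier (Mor a (edge \<sigma> ! i) (vert \<sigma> ! i) (vert \<sigma> ! Suc i))" for x
        using tuples_update[OF s(2), of x i] that i s(1) by (simp add: edge_modules_def simplex_lengths)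
      then show "linear_map k (Mor a (edge \<sigma> ! i) (vert \<sigma> ! i) (vert \<sigma> ! Suc i)) (coeff U N \<sigma>)
          (\<lambda>x. coeff_map U a h n \<phi> \<sigma> (as[i := x]))"
        using s(1)
        by (intro linear_map_cong[OF linear_map_comp[OF cochain_linear[OF \<phi> s i] hc[OF s(1)]]]) (simp add: coeff_map_def)
    qed (simp_all add: coeff_map_def)
  qed
qed


section \<open>Naturality of the differential\<close>

text \<open>A relation instead of a map on cochains: \<open>\<psi>\<close> on \<open>b\<close> and \<open>\<phi>\<close> on \<open>a\<close> agree along \<open>F\<close> once the values
  of \<open>\<psi>\<close> are transported by \<open>h\<close>. For \<open>h\<close> the identity it says that \<open>\<psi>\<close> is the pullback of \<open>\<phi>\<close>; for
  \<open>h\<close> given by \<open>F\<close> it is \<open>F \<circ> \<psi> = \<phi> \<circ> F\<^sup>\<otimes>\<^sup>n\<close>, which avoids the inverse of \<open>F\<close>.\<close>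

definition intertwines ::
  "('vo, 'v) cat \<Rightarrow> ('vo, 'v, 'y, 'k, 'n) gcat \<Rightarrow> ('vo, 'v, 'y, 'n, 'uo, 'u, 'x, 'm) gfun \<Rightarrow>
    ('v \<Rightarrow> 'y \<Rightarrow> 'y \<Rightarrow> 'q \<Rightarrow> 'p) \<Rightarrow> nat \<Rightarrow>
    ('vo, 'v, 'y, 'n, 'q) cochain \<Rightarrow> ('uo, 'u, 'x, 'm, 'p) cochain \<Rightarrow> bool" where
  "intertwines V b F h n \<psi> \<phi> \<longleftrightarrow> (\<forall>\<sigma> \<in> simplices V b n. \<forall>as \<in> args b \<sigma>.
     h (total V \<sigma>) (hd (vert \<sigma>)) (last (vert \<sigma>)) (\<psi> \<sigma> as) = \<phi> (map_simplex F \<sigma>) (map_args F \<sigma> as))"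

lemma intertwinesD:
  assumes "intertwines V b F h n \<psi> \<phi>" "\<sigma> \<in> simplices V b n" "as \<in> args b \<sigma>"
  shows "h (total V \<sigma>) (hd (vert \<sigma>)) (last (vert \<sigma>)) (\<psi> \<sigma> as) = \<phi> (map_simplex F \<sigma>) (map_args F \<sigma> as)"
  using assms by (simp add: intertwines_def)

text \<open>A morphism of \<open>b\<close>-bimodules from \<open>N\<close> to the pullback of \<open>M\<close>, stated in terms of \<open>M\<close>. Two instances
  matter: the identity of the pullback, and \<open>F\<close> itself as a morphism from \<open>b\<close> to the pullback of \<open>a\<close>.\<close>

locale coefficient_hom = graded_functor k V b U a F + M: bimodule k U a M + N: bimodule k V b N
  for k :: "('k, 'r) ring_scheme"
    and V :: "('vo, 'v) cat" and b :: "('vo, 'v, 'y, 'k, 'n) gcat"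
    and U :: "('uo, 'u) cat" and a :: "('uo, 'u, 'x, 'k, 'm) gcat"
    and F :: "('vo, 'v, 'y, 'n, 'uo, 'u, 'x, 'm) gfun"
    and M :: "('u, 'x, 'k, 'm, 'p) bimod" and N :: "('v, 'y, 'k, 'n, 'q) bimod" +
  fixes h :: "'v \<Rightarrow> 'y \<Rightarrow> 'y \<Rightarrow> 'q \<Rightarrow> 'p"
  assumes h_linear: "\<lbrakk>v \<in> Arr V; B \<in> obs b (src V v); B' \<in> obs b (tgt V v)\<rbrakk>
      \<Longrightarrow> linear_map k (Bm N v B B') (Bm M (farr F v) (Fob F (src V v) B) (Fob F (tgt V v) B')) (h v B B')"
    and h_lact: "\<lbrakk>v \<in> Arr V; w \<in> Arr V; tgt V v = src V w;
        B \<in> obs b (src V v); B' \<in> obs b (tgt V v); B'' \<in> obs b (tgt V w);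
        g \<in> carrier (Mor b w B' B''); m \<in> carrier (Bm N v B B')\<rbrakk>
      \<Longrightarrow> h (ccomp V w v) B B'' (lact N w v B B' B'' g m) =
        lact M (farr F w) (farr F v) (Fob F (src V v) B) (Fob F (tgt V v) B') (Fob F (tgt V w) B'')
          (Fmor F w B' B'' g) (h v B B' m)"
    and h_ract: "\<lbrakk>v \<in> Arr V; w \<in> Arr V; tgt V v = src V w;
        B \<in> obs b (src V v); B' \<in> obs b (tgt V v); B'' \<in> obs b (tgt V w);
        m \<in> carrier (Bm N w B' B''); f \<in> carrier (Mor b v B B')\<rbrakk>
      \<Longrightarrow> h (ccomp V w v) B B'' (ract N w v B B' B'' m f) =
        ract M (farr F w) (farr F v) (Fob F (src V v) B) (Fob F (tgt V v) B') (Fob F (tgt V w) B'')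
          (h w B' B'' m) (Fmor F v B B' f)"
begin

abbreviation H where "H \<sigma> \<equiv> h (total V \<sigma>) (hd (vert \<sigma>)) (last (vert \<sigma>))"

lemma H_linear:
  assumes \<sigma>: "\<sigma> \<in> simplices V b n"
  shows "linear_map k (coeff V N \<sigma>) (coeff U M (map_simplex F \<sigma>)) (H \<sigma>)"
  using h_linear[of "total V \<sigma>" "hd (vert \<sigma>)" "last (vert \<sigma>)"] simplexD(2)[OF \<sigma>, of 0] simplexD(2)[OF \<sigma>, of n]
  by (simp add: coeff_map_simplex[OF \<sigma>] coeff_def[of V] pullback_bimodule_def simplex_ends[OF \<sigma>] dom.total_closed[OF \<sigma>])

text \<open>The naturality of the differential, for a pullback as well as for \<open>F\<^sup>*\<close>. Since \<open>h\<close> is additive, it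
  may be moved into the sum. It then passes through the two outer terms by its compatibility with the
  actions, and through the inner terms because faces do not change the composite.\<close>

lemma intertwines_hochschild_d:
  assumes \<psi>: "\<psi> \<in> carrier (cochains k V b N n)" and int: "intertwines V b F h n \<psi> \<phi>"
  shows "intertwines V b F h (Suc n) (hochschild_d V b N n \<psi>) (hochschild_d U a M n \<phi>)"
  unfolding intertwines_def
proof (intro ballI)
  fix \<sigma> as assume \<sigma>: "\<sigma> \<in> simplices V b (Suc n)" and as: "as \<in> args b \<sigma>"
  define \<tau> where "\<tau> = map_simplex F \<sigma>"
  define cs where "cs = map_args F \<sigma> as"
  have \<tau>: "\<tau> \<in> simplices U a (Suc n)" unfolding \<tau>_def by (rule map_simplex_simplex[OF \<sigma>])
  have cs: "cs \<in> args a \<tau>" unfolding \<tau>_def cs_def by (rule map_args_closed[OF \<sigma> as])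
  have int': "H \<rho> (\<psi> \<rho> bs) = \<phi> (map_simplex F \<rho>) (map_args F \<rho> bs)"
    if "\<rho> \<in> simplices V b n" "bs \<in> args b \<rho>" for \<rho> bs
    using int that by (simp add: intertwines_def)
  interpret H: linear_map k "coeff V N \<sigma>" "coeff U M \<tau>" "H \<sigma>"
    unfolding \<tau>_def by (rule H_linear[OF \<sigma>])
  have arg: "as ! i \<in> carrier (Mor b (edge \<sigma> ! i) (vert \<sigma> ! i) (vert \<sigma> ! Suc i))" if "i \<le> n" for i
    using as simplex_lengths[OF \<sigma>] that by (simp add: args_iff)
  have nths: "i \<le> n \<Longrightarrow> edge \<tau> ! i = farr F (edge \<sigma> ! i)" "i \<le> Suc n \<Longrightarrow> vert \<tau> ! i = Fob F (base \<sigma> ! i) (vert \<sigma> ! i)"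
    "i \<le> n \<Longrightarrow> cs ! i = Fmor F (edge \<sigma> ! i) (vert \<sigma> ! i) (vert \<sigma> ! Suc i) (as ! i)" for i
    by (simp_all add: \<tau>_def cs_def map_simplex_nth[OF \<sigma>] map_args_nth[OF \<sigma>])

  let ?l = "lact N (edge \<sigma> ! n) (total V (segment 0 n \<sigma>)) (vert \<sigma> ! 0) (vert \<sigma> ! n) (vert \<sigma> ! Suc n)
       (as ! n) (\<psi> (segment 0 n \<sigma>) (seg_args 0 n as))"
  let ?r = "ract N (total V (segment 1 (Suc n) \<sigma>)) (edge \<sigma> ! 0) (vert \<sigma> ! 0) (vert \<sigma> ! 1) (vert \<sigma> ! Suc n)
          (\<psi> (segment 1 (Suc n) \<sigma>) (seg_args 1 (Suc n) as)) (as ! 0)"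
  let ?f = "\<lambda>i. \<psi> (face V (Suc n - i) \<sigma>) (merge b (Suc n - i) \<sigma> as)"
  have closed: "?l \<in> carrier (coeff V N \<sigma>)" "?r \<in> carrier (coeff V N \<sigma>)" "i \<in> {1..n} \<Longrightarrow> ?f i \<in> carrier (coeff V N \<sigma>)" for i
    using N.lact_term_closed[OF \<sigma> as N.outer_values_closed(1)[OF \<sigma> as \<psi>]]
      N.ract_term_closed[OF \<sigma> as N.outer_values_closed(2)[OF \<sigma> as \<psi>]] N.face_term_closed[OF \<sigma> as \<psi>] by blast+
  note S = signed_closed[OF H.M.module_axioms]

  have l: "H \<sigma> ?l = lact M (edge \<tau> ! n) (total U (segment 0 n \<tau>)) (vert \<tau> ! 0) (vert \<tau> ! n) (vert \<tau> ! Suc n)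
       (cs ! n) (\<phi> (segment 0 n \<tau>) (seg_args 0 n cs))"
  proof -
    have t: "total V \<sigma> = ccomp V (edge \<sigma> ! n) (total V (segment 0 n \<sigma>))"
      using dom.total_segment_Suc[OF \<sigma>, of 0 n] by (simp add: segment_all[OF \<sigma>])
    have "\<phi> (segment 0 n \<tau>) (seg_args 0 n cs) = H (segment 0 n \<sigma>) (\<psi> (segment 0 n \<sigma>) (seg_args 0 n as))"
      using int'[of "segment 0 n \<sigma>" "seg_args 0 n as"] segment_simplex[OF \<sigma>, of 0 n] seg_args_closed[OF \<sigma> _ _ as, of 0 n]
      by (simp add: \<tau>_def cs_def map_simplex_segment map_args_segment[OF \<sigma> _ _ as])
    moreover have "total U (segment 0 n \<tau>) = farr F (total V (segment 0 n \<sigma>))"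
      by (simp add: \<tau>_def total_segment_map_simplex[OF \<sigma>])
    ultimately show ?thesis
      using N.outer_values_closed(1)[OF \<sigma> as \<psi>] arg[of n] dom.total_segment[OF \<sigma>, of 0 n] simplexD[OF \<sigma>, of n]
        simplexD(2)[OF \<sigma>, of 0] simplexD(2)[OF \<sigma>, of "Suc n"]
      by (simp add: t simplex_ends[OF \<sigma>] segment_ends[OF \<sigma>] nths h_lact coeff_def)
  qed
  have r: "H \<sigma> ?r = ract M (total U (segment 1 (Suc n) \<tau>)) (edge \<tau> ! 0) (vert \<tau> ! 0) (vert \<tau> ! 1) (vert \<tau> ! Suc n)
          (\<phi> (segment 1 (Suc n) \<tau>) (seg_args 1 (Suc n) cs)) (cs ! 0)"
  proof -
    have t: "total V \<sigma> = ccomp V (total V (segment 1 (Suc n) \<sigma>)) (edge \<sigma> ! 0)"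
      using dom.total_segment_append[OF \<sigma>, of 0 1 "Suc n"] dom.total_segment_edge[OF \<sigma>, of 0]
      by (simp add: segment_all[OF \<sigma>])
    have "\<phi> (segment 1 (Suc n) \<tau>) (seg_args 1 (Suc n) cs) =
        H (segment 1 (Suc n) \<sigma>) (\<psi> (segment 1 (Suc n) \<sigma>) (seg_args 1 (Suc n) as))"
      using int'[of "segment 1 (Suc n) \<sigma>" "seg_args 1 (Suc n) as"] segment_simplex[OF \<sigma>, of 1 "Suc n"]
        seg_args_closed[OF \<sigma> _ _ as, of 1 "Suc n"]
      by (simp add: \<tau>_def cs_def map_simplex_segment map_args_segment[OF \<sigma> _ _ as])
    moreover have "total U (segment 1 (Suc n) \<tau>) = farr F (total V (segment 1 (Suc n) \<sigma>))"
      by (simp add: \<tau>_def total_segment_map_simplex[OF \<sigma>])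
    ultimately show ?thesis
      using N.outer_values_closed(2)[OF \<sigma> as \<psi>] arg[of 0] dom.total_segment[OF \<sigma>, of 1 "Suc n"] simplexD[OF \<sigma>, of 0]
        simplexD(2)[OF \<sigma>, of 1] simplexD(2)[OF \<sigma>, of "Suc n"]
      by (simp add: t simplex_ends[OF \<sigma>] segment_ends[OF \<sigma>] nths h_ract coeff_def)
  qed
  have f: "H \<sigma> (?f i) = \<phi> (face U (Suc n - i) \<tau>) (merge a (Suc n - i) \<tau> cs)" if "i \<in> {1..n}" for i
  proof -
    have j: "1 \<le> Suc n - i" "Suc n - i \<le> n" using that by auto
    have "H (face V (Suc n - i) \<sigma>) = H \<sigma>"
      using dom.total_face[OF \<sigma> j] by simp
    then show ?thesis
      using int'[OF dom.face_simplex[OF \<sigma> j] dom.merge_closed[OF \<sigma> j as]]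
      by (simp add: \<tau>_def cs_def map_simplex_face[OF \<sigma> j] map_args_merge[OF \<sigma> j as])
  qed
  have fin: "H \<sigma> (\<Oplus>\<^bsub>coeff V N \<sigma>\<^esub> i \<in> {1..n}. signed (coeff V N \<sigma>) i (?f i)) =
    (\<Oplus>\<^bsub>coeff U M \<tau>\<^esub> i \<in> {1..n}. signed (coeff U M \<tau>) i (\<phi> (face U (Suc n - i) \<tau>) (merge a (Suc n - i) \<tau> cs)))"
    (is "_ = finsum _ ?g _")
  proof -
    have g: "?g i = H \<sigma> (signed (coeff V N \<sigma>) i (?f i))" if "i \<in> {1..n}" for i
      using that closed(3)[of i] f[of i] by (simp add: H.map_signed)
    show ?thesis
      by (subst H.map_finsum) (use S[OF closed(3)] in \<open>auto intro!: H.N.M.finsum_cong' simp: g H.closed\<close>)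
  qed
  show "H \<sigma> (hochschild_d V b N n \<psi> \<sigma> as) = hochschild_d U a M n \<phi> (map_simplex F \<sigma>) (map_args F \<sigma> as)"
    using \<sigma> as \<tau> cs closed S
    unfolding hochschild_d_def \<tau>_def[symmetric] cs_def[symmetric]
    by (simp add: H.add H.M.M.finsum_closed H.map_signed l r[unfolded One_nat_def] fin[unfolded One_nat_def] Pi_def)
qed

end


text \<open>The case \<open>h = id\<close>, in which the relation \<open>intertwines\<close> determines \<open>\<psi>\<close> from \<open>\<phi>\<close>.\<close>

lemma (in graded_functor) pullback_cochain_hochschild_d:
  assumes M: "bimodule k U a M" and \<phi>: "\<phi> \<in> carrier (cochains k U a M n)"
  shows "pullback_cochain V b F (Suc n) (hochschild_d U a M n \<phi>) =
    hochschild_d V b (pullback_bimodule V F M) n (pullback_cochain V b F n \<phi>)"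
proof -
  let ?N = "pullback_bimodule V F M"
  interpret M: bimodule k U a M by fact
  interpret N: bimodule k V b ?N by (rule pullback_bimodule_bimodule[OF M])
  interpret coefficient_hom k V b U a F M ?N "\<lambda>_ _ _ m. m"
  proof (intro coefficient_hom.intro coefficient_hom_axioms.intro graded_functor_axioms
      M.bimodule_axioms N.bimodule_axioms)
    fix v B B' assume v: "v \<in> Arr V" "B \<in> obs b (src V v)" "B' \<in> obs b (tgt V v)"
    show "linear_map k (Bm ?N v B B') (Bm M (farr F v) (Fob F (src V v) B) (Fob F (tgt V v) B')) (\<lambda>m. m)"
      using linear_map_id[OF N.Bm_module[OF v]] by (simp add: pullback_bimodule_def)
  qed (simp_all add: pullback_bimodule_def)
  have "intertwines V b F (\<lambda>_ _ _ m. m) n (pullback_cochain V b F n \<phi>) \<phi>"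
    by (simp add: intertwines_def pullback_cochain_def)
  from intertwines_hochschild_d[OF linear_map.closed[OF pullback_cochain_linear[OF M] \<phi>] this]
  show ?thesis
    unfolding pullback_cochain_def[of V b F "Suc n"] hochschild_d_def[of V b ?N n]
    by (intro restrict_ext) (simp add: intertwines_def hochschild_d_def)
qed


section \<open>Cup products and braces\<close>

context graded_category
begin

lemma cup_value_closed:
  assumes \<phi>: "\<phi> \<in> carrier (cochains k U a (unit_bimodule a) p)"
    and \<psi>: "\<psi> \<in> carrier (cochains k U a (unit_bimodule a) q)"
    and \<sigma>: "\<sigma> \<in> simplices U a (p + q)" and as: "as \<in> args a \<sigma>"
  shows "\<phi> (segment q (p + q) \<sigma>) (seg_args q (p + q) as) \<in>
      carrier (Mor a (total U (segment q (p + q) \<sigma>)) (vert \<sigma> ! q) (vert \<sigma> ! (p + q)))"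
    "\<psi> (segment 0 q \<sigma>) (seg_args 0 q as) \<in> carrier (Mor a (total U (segment 0 q \<sigma>)) (vert \<sigma> ! 0) (vert \<sigma> ! q))"
  using cochain_closed[OF \<phi> _ seg_args_closed[OF \<sigma> _ _ as], of q "p + q"] segment_simplex[OF \<sigma>, of q "p + q"]
    cochain_closed[OF \<psi> _ seg_args_closed[OF \<sigma> _ _ as], of 0 q] segment_simplex[OF \<sigma>, of 0 q]
  by (simp_all add: coeff_unit_bimodule segment_ends[OF \<sigma>])

lemma total_split:
  assumes \<sigma>: "\<sigma> \<in> simplices U a n" and "q \<le> n"
  shows "total U \<sigma> = ccomp U (total U (segment q n \<sigma>)) (total U (segment 0 q \<sigma>))"
  using total_segment_append[OF \<sigma>, of 0 q n] assms by (simp add: segment_all[OF \<sigma>])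

lemma mcomp_split_bilinear:
  assumes \<sigma>: "\<sigma> \<in> simplices U a n" and q: "q \<le> n"
  shows "bilinear_map k (Mor a (total U (segment q n \<sigma>)) (vert \<sigma> ! q) (vert \<sigma> ! n))
    (Mor a (total U (segment 0 q \<sigma>)) (vert \<sigma> ! 0) (vert \<sigma> ! q)) (coeff U (unit_bimodule a) \<sigma>)
    (mcomp a (total U (segment q n \<sigma>)) (total U (segment 0 q \<sigma>)) (vert \<sigma> ! 0) (vert \<sigma> ! q) (vert \<sigma> ! n))"
  unfolding coeff_unit_bimodule total_split[OF assms] simplex_ends[OF \<sigma>]
  using q total_segment[OF \<sigma>, of 0 q] total_segment[OF \<sigma>, of q n] simplexD(2)[OF \<sigma>]
  by (intro mcomp_bilinear) simp_all

text \<open>An argument belongs to exactly one of the two blocks \<open>{..<q}\<close> and \<open>{q..<p + q}\<close>, so the cup product is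
  linear in it because one factor is and the composition is bilinear. Membership in the module of
  cochains is needed because the differential of the \<open>B\<^sub>\<infinity>\<close>-structure contains the cup product with a sign,
  and a linear map is compatible with negation only on the carrier.\<close>

lemma cup_closed:
  assumes \<phi>: "\<phi> \<in> carrier (cochains k U a (unit_bimodule a) p)"
    and \<psi>: "\<psi> \<in> carrier (cochains k U a (unit_bimodule a) q)"
  shows "cup U a p \<phi> q \<psi> \<in> carrier (cochains k U a (unit_bimodule a) (p + q))"
proof (rule cochainsI)
  fix \<sigma> as assume \<sigma>: "\<sigma> \<in> simplices U a (p + q)" and as: "as \<in> args a \<sigma>"
  note bil = mcomp_split_bilinear[OF \<sigma>, of q, simplified]
  note vals = cup_value_closed[OF \<phi> \<psi> \<sigma> as]
  have s1: "segment q (p + q) \<sigma> \<in> simplices U a p" "seg_args q (p + q) as \<in> args a (segment q (p + q) \<sigma>)"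
    and s0: "segment 0 q \<sigma> \<in> simplices U a q" "seg_args 0 q as \<in> args a (segment 0 q \<sigma>)"
    using segment_simplex[OF \<sigma>, of q "p + q"] seg_args_closed[OF \<sigma> _ _ as, of q "p + q"]
      segment_simplex[OF \<sigma>, of 0 q] seg_args_closed[OF \<sigma> _ _ as, of 0 q] by simp_all
  show "cup U a p \<phi> q \<psi> \<sigma> as \<in> carrier (coeff U (unit_bimodule a) \<sigma>)"
    using bilinear_map_closed[OF bil vals] \<sigma> as by (simp add: cup_def)
  fix i assume i: "i < p + q"
  let ?X = "Mor a (edge \<sigma> ! i) (vert \<sigma> ! i) (vert \<sigma> ! Suc i)"
  have upd: "cup U a p \<phi> q \<psi> \<sigma> (as[i := x]) =
      mcomp a (total U (segment q (p + q) \<sigma>)) (total U (segment 0 q \<sigma>)) (vert \<sigma> ! 0) (vert \<sigma> ! q) (vert \<sigma> ! (p + q))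
       (\<phi> (segment q (p + q) \<sigma>) (seg_args q (p + q) (as[i := x]))) (\<psi> (segment 0 q \<sigma>) (seg_args 0 q (as[i := x])))"
    if "x \<in> carrier ?X" for x
    using tuples_update[OF as, of x i] that i \<sigma> by (simp add: edge_modules_def simplex_lengths cup_def)
  show "linear_map k ?X (coeff U (unit_bimodule a) \<sigma>) (\<lambda>x. cup U a p \<phi> q \<psi> \<sigma> (as[i := x]))"
  proof (cases "i < q")
    case True
    then have e: "seg_args q (p + q) (as[i := x]) = seg_args q (p + q) as"
      "seg_args 0 q (as[i := x]) = (seg_args 0 q as)[i := x]" for x
      by (simp_all add: seg_args_def drop_update_cancel take_update_swap)
    have "linear_map k ?X (Mor a (total U (segment 0 q \<sigma>)) (vert \<sigma> ! 0) (vert \<sigma> ! q))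
        (\<lambda>x. \<psi> (segment 0 q \<sigma>) ((seg_args 0 q as)[i := x]))"
      using cochain_linear[OF \<psi> s0 True] True
      by (simp add: coeff_unit_bimodule segment_ends[OF \<sigma>] segment_nth[OF \<sigma>])
    from linear_map_comp[OF this bil[unfolded bilinear_map_def, THEN conjunct1, THEN bspec, OF vals(1)]]
    show ?thesis by (rule linear_map_cong) (simp add: upd e)
  next
    case False
    then have e: "seg_args q (p + q) (as[i := x]) = (seg_args q (p + q) as)[i - q := x]"
      "seg_args 0 q (as[i := x]) = seg_args 0 q as" for x
      by (simp_all add: seg_args_def drop_update_swap take_update_swap list_update_beyond)
    have "linear_map k ?X (Mor a (total U (segment q (p + q) \<sigma>)) (vert \<sigma> ! q) (vert \<sigma> ! (p + q)))
        (\<lambda>x. \<phi> (segment q (p + q) \<sigma>) ((seg_args q (p + q) as)[i - q := x]))"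
      using cochain_linear[OF \<phi> s1, of "i - q"] False i
      by (simp add: coeff_unit_bimodule segment_ends[OF \<sigma>] segment_nth[OF \<sigma>])
    from linear_map_comp[OF this bil[unfolded bilinear_map_def, THEN conjunct2, THEN bspec, OF vals(2)]]
    show ?thesis by (rule linear_map_cong) (simp add: upd e)
  qed
qed (simp_all add: cup_def)

context
  fixes p :: nat and qs :: "nat list" and n :: nat and ss :: "nat list" and \<sigma> :: "('o, 'u, 'x) simplex"
  assumes \<sigma>: "\<sigma> \<in> simplices U a (p + sum_list qs - length qs)"
    and ss: "ss \<in> insertions p (length qs)"
begin

lemma cut_le: "\<lbrakk>s \<le> t; t \<le> p\<rbrakk> \<Longrightarrow> cut qs ss s \<le> cut qs ss t"
  using cut_step by (metis lift_Suc_mono_le)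

lemma cut_bound: "s \<le> p \<Longrightarrow> cut qs ss s \<le> p + sum_list qs - length qs"
  using cut_le[of s p] cut_total[OF ss] by simp

lemma contract_simplex: "contract U p qs ss \<sigma> \<in> simplices U a p"
  unfolding contract_eq_coarsen by (rule coarsen_simplex[OF \<sigma>]) (simp_all add: cut_step cut_total[OF ss])

lemma total_contract:
  "total U (contract U p qs ss \<sigma>) = total U \<sigma>" "hd (vert (contract U p qs ss \<sigma>)) = hd (vert \<sigma>)"
  "last (vert (contract U p qs ss \<sigma>)) = last (vert \<sigma>)"
  unfolding contract_eq_coarsen
  by (rule total_coarsen[OF \<sigma>]; simp add: cut_step cut_total[OF ss] cut_0)+

lemma contract_nth:
  "s < p \<Longrightarrow> edge (contract U p qs ss \<sigma>) ! s = total U (segment (cut qs ss s) (cut qs ss (Suc s)) \<sigma>)"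
  "s \<le> p \<Longrightarrow> vert (contract U p qs ss \<sigma>) ! s = vert \<sigma> ! cut qs ss s"
  by (auto simp: contract_def nth_append)

text \<open>An operation inserted in a slot takes its value over the composite of the block that it consumes,
  which is the edge of the contracted simplex at that slot.\<close>

lemma insert_args_closed:
  assumes \<psi>s: "homogeneous (cochains k U a (unit_bimodule a)) qs \<psi>s" and as: "as \<in> args a \<sigma>"
  shows "insert_args p qs \<psi>s ss \<sigma> as \<in> args a (contract U p qs ss \<sigma>)"
  unfolding args_iff
proof (intro conjI allI impI)
  show "length (insert_args p qs \<psi>s ss \<sigma> as) = length (edge (contract U p qs ss \<sigma>))"
    by (simp add: insert_args_def contract_def)
  fix s assume "s < length (edge (contract U p qs ss \<sigma>))"
  then have s: "s < p" by (simp add: contract_def)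
  have l: "length \<psi>s = length qs" and \<psi>: "\<And>i. i < length qs \<Longrightarrow> \<psi>s ! i \<in> carrier (cochains k U a (unit_bimodule a) (qs ! i))"
    using \<psi>s by (simp_all add: homogeneous_def list_all2_conv_all_nth)
  have c: "cut qs ss s \<le> cut qs ss (Suc s)" "cut qs ss (Suc s) \<le> p + sum_list qs - length qs"
    using s cut_bound[of "Suc s"] by (simp_all add: cut_step)
  have "insert_args p qs \<psi>s ss \<sigma> as ! s \<in> carrier (Mor a (total U (segment (cut qs ss s) (cut qs ss (Suc s)) \<sigma>))
      (vert \<sigma> ! cut qs ss s) (vert \<sigma> ! cut qs ss (Suc s)))"
  proof (rule slot_cases[OF ss l l, of s])
    assume N: "map_of (zip ss \<psi>s) s = None" "cut qs ss (Suc s) = Suc (cut qs ss s)"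
    then show ?thesis
      using s c as total_segment_edge[OF \<sigma>, of "cut qs ss s"]
      by (simp add: insert_args_def args_iff simplex_lengths[OF \<sigma>])
  next
    fix i assume i: "i < length qs" "map_of (zip ss \<psi>s) s = Some (\<psi>s ! i)" "cut qs ss (Suc s) = cut qs ss s + qs ! i"
    then show ?thesis
      using s segment_simplex[OF \<sigma> c] cochain_closed[OF \<psi>[OF i(1)] _ seg_args_closed[OF \<sigma> c as]]
      by (simp add: insert_args_def coeff_unit_bimodule segment_ends[OF \<sigma> c, unfolded i(3)])
  qed
  then show "insert_args p qs \<psi>s ss \<sigma> as ! s \<in> carrier (Mor a (edge (contract U p qs ss \<sigma>) ! s)
      (vert (contract U p qs ss \<sigma>) ! s) (vert (contract U p qs ss \<sigma>) ! Suc s))"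
    using s by (simp add: contract_nth)
qed

lemma brace_term_closed:
  assumes \<phi>: "\<phi> \<in> carrier (cochains k U a (unit_bimodule a) p)"
    and \<psi>s: "homogeneous (cochains k U a (unit_bimodule a)) qs \<psi>s" and as: "as \<in> args a \<sigma>"
  shows "\<phi> (contract U p qs ss \<sigma>) (insert_args p qs \<psi>s ss \<sigma> as) \<in> carrier (coeff U (unit_bimodule a) \<sigma>)"
  using cochain_closed[OF \<phi> contract_simplex insert_args_closed[OF \<psi>s as]]
  by (simp add: coeff_unit_bimodule total_contract)

end

lemma brace_value_closed:
  assumes \<phi>: "\<phi> \<in> carrier (cochains k U a (unit_bimodule a) p)"
    and \<psi>s: "homogeneous (cochains k U a (unit_bimodule a)) qs \<psi>s"
    and \<sigma>: "\<sigma> \<in> simplices U a (p + sum_list qs - length qs)" and as: "as \<in> args a \<sigma>"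
  shows "brace U a p \<phi> qs \<psi>s \<sigma> as \<in> carrier (coeff U (unit_bimodule a) \<sigma>)"
proof -
  interpret C: module k "coeff U (unit_bimodule a) \<sigma>"
    by (rule bimodule.coeff_module[OF unit_bimodule_bimodule \<sigma>])
  show ?thesis
    using \<sigma> as brace_term_closed[OF \<sigma> _ \<phi> \<psi>s as]
    by (auto simp: brace_def intro!: C.M.finsum_closed signed_closed[OF C.module_axioms])
qed

end

context graded_functor
begin

lemma Fmor_coefficient_hom: "coefficient_hom k V b U a F (unit_bimodule a) (unit_bimodule b) (Fmor F)"
  by (intro coefficient_hom.intro coefficient_hom_axioms.intro graded_functor_axioms
        cod.unit_bimodule_bimodule dom.unit_bimodule_bimodule; unfold unit_bimodule_def bimod.simps)
    (erule (2) Fmor_linear, (rule Fmor_comp; assumption)+)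

lemma intertwines_cup:
  assumes \<psi>1: "\<psi>1 \<in> carrier (cochains k V b (unit_bimodule b) p)" "intertwines V b F (Fmor F) p \<psi>1 \<phi>1"
    and \<psi>2: "\<psi>2 \<in> carrier (cochains k V b (unit_bimodule b) q)" "intertwines V b F (Fmor F) q \<psi>2 \<phi>2"
  shows "intertwines V b F (Fmor F) (p + q) (cup V b p \<psi>1 q \<psi>2) (cup U a p \<phi>1 q \<phi>2)"
  unfolding intertwines_def
proof (intro ballI)
  fix \<sigma> as assume \<sigma>: "\<sigma> \<in> simplices V b (p + q)" and as: "as \<in> args b \<sigma>"
  note vals = dom.cup_value_closed[OF \<psi>1(1) \<psi>2(1) \<sigma> as]
  define \<tau> where "\<tau> = map_simplex F \<sigma>"
  define cs where "cs = map_args F \<sigma> as"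
  have \<tau>: "\<tau> \<in> simplices U a (p + q)" unfolding \<tau>_def by (rule map_simplex_simplex[OF \<sigma>])
  have cs: "cs \<in> args a \<tau>" unfolding \<tau>_def cs_def by (rule map_args_closed[OF \<sigma> as])
  have "\<phi>1 (segment q (p + q) \<tau>) (seg_args q (p + q) cs) =
      Fmor F (total V (segment q (p + q) \<sigma>)) (vert \<sigma> ! q) (vert \<sigma> ! (p + q))
        (\<psi>1 (segment q (p + q) \<sigma>) (seg_args q (p + q) as))"
    using intertwinesD[OF \<psi>1(2), of "segment q (p + q) \<sigma>" "seg_args q (p + q) as"]
      segment_simplex[OF \<sigma>, of q "p + q"] seg_args_closed[OF \<sigma> _ _ as, of q "p + q"]
    by (simp add: \<tau>_def cs_def segment_ends[OF \<sigma>] flip: map_simplex_segment map_args_segment[OF \<sigma> _ _ as])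
  moreover have "\<phi>2 (segment 0 q \<tau>) (seg_args 0 q cs) =
      Fmor F (total V (segment 0 q \<sigma>)) (vert \<sigma> ! 0) (vert \<sigma> ! q) (\<psi>2 (segment 0 q \<sigma>) (seg_args 0 q as))"
    using intertwinesD[OF \<psi>2(2), of "segment 0 q \<sigma>" "seg_args 0 q as"]
      segment_simplex[OF \<sigma>, of 0 q] seg_args_closed[OF \<sigma> _ _ as, of 0 q]
    by (simp add: \<tau>_def cs_def segment_ends[OF \<sigma>] flip: map_simplex_segment map_args_segment[OF \<sigma> _ _ as])
  moreover have "total U (segment q (p + q) \<tau>) = farr F (total V (segment q (p + q) \<sigma>))"
    "total U (segment 0 q \<tau>) = farr F (total V (segment 0 q \<sigma>))"
    by (simp_all add: \<tau>_def total_segment_map_simplex[OF \<sigma>])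
  moreover have "i \<le> p + q \<Longrightarrow> vert \<tau> ! i = Fob F (base \<sigma> ! i) (vert \<sigma> ! i)" for i
    by (simp add: \<tau>_def map_simplex_nth[OF \<sigma>])
  ultimately show "Fmor F (total V \<sigma>) (hd (vert \<sigma>)) (last (vert \<sigma>)) (cup V b p \<psi>1 q \<psi>2 \<sigma> as) =
      cup U a p \<phi>1 q \<phi>2 (map_simplex F \<sigma>) (map_args F \<sigma> as)"
    using \<sigma> as \<tau> cs vals dom.total_segment[OF \<sigma>, of 0 q] dom.total_segment[OF \<sigma>, of q "p + q"] simplexD(2)[OF \<sigma>]
    unfolding \<tau>_def[symmetric] cs_def[symmetric]
    by (simp add: cup_def dom.total_split[OF \<sigma>, of q] simplex_ends[OF \<sigma>] Fmor_comp)
qed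

lemma map_simplex_contract:
  assumes \<sigma>: "\<sigma> \<in> simplices V b (p + sum_list qs - length qs)" and ss: "ss \<in> insertions p (length qs)"
  shows "map_simplex F (contract V p qs ss \<sigma>) = contract U p qs ss (map_simplex F \<sigma>)"
  unfolding contract_eq_coarsen
  by (rule map_simplex_coarsen[OF \<sigma>]) (simp_all add: cut_step cut_total[OF ss])

text \<open>In a slot that passes on its argument both sides apply \<open>F\<close> to it; in a slot receiving an operation the
  equality is the intertwining relation for that operation, at the block that it consumes.\<close>

lemma map_args_insert_args:
  assumes \<sigma>: "\<sigma> \<in> simplices V b (p + sum_list qs - length qs)" and ss: "ss \<in> insertions p (length qs)"
    and as: "as \<in> args b \<sigma>" and l: "length \<psi>s = length qs" "length \<phi>s = length qs"
    and int: "\<And>i. i < length qs \<Longrightarrow> intertwines V b F (Fmor F) (qs ! i) (\<psi>s ! i) (\<phi>s ! i)"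
  shows "map_args F (contract V p qs ss \<sigma>) (insert_args p qs \<psi>s ss \<sigma> as) =
    insert_args p qs \<phi>s ss (map_simplex F \<sigma>) (map_args F \<sigma> as)"
proof (rule nth_equalityI)
  note con = dom.contract_simplex[OF \<sigma> ss]
  show "length (map_args F (contract V p qs ss \<sigma>) (insert_args p qs \<psi>s ss \<sigma> as)) =
      length (insert_args p qs \<phi>s ss (map_simplex F \<sigma>) (map_args F \<sigma> as))"
    by (simp add: length_map_args simplex_lengths[OF con] insert_args_def)
  fix s assume "s < length (map_args F (contract V p qs ss \<sigma>) (insert_args p qs \<psi>s ss \<sigma> as))"
  then have s: "s < p" by (simp add: length_map_args simplex_lengths[OF con])
  have c: "cut qs ss s \<le> cut qs ss (Suc s)" "cut qs ss (Suc s) \<le> p + sum_list qs - length qs"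
    using s dom.cut_bound[OF \<sigma> ss, of "Suc s"] by (simp_all add: cut_step)
  have lhs: "map_args F (contract V p qs ss \<sigma>) (insert_args p qs \<psi>s ss \<sigma> as) ! s =
      Fmor F (total V (segment (cut qs ss s) (cut qs ss (Suc s)) \<sigma>)) (vert \<sigma> ! cut qs ss s) (vert \<sigma> ! cut qs ss (Suc s))
        (insert_args p qs \<psi>s ss \<sigma> as ! s)"
    using s by (simp add: map_args_nth[OF con] dom.contract_nth[OF \<sigma> ss])
  show "map_args F (contract V p qs ss \<sigma>) (insert_args p qs \<psi>s ss \<sigma> as) ! s =
      insert_args p qs \<phi>s ss (map_simplex F \<sigma>) (map_args F \<sigma> as) ! s"
  proof (rule slot_cases[OF ss l, of s])
    assume "map_of (zip ss \<psi>s) s = None" "map_of (zip ss \<phi>s) s = None" "cut qs ss (Suc s) = Suc (cut qs ss s)"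
    then show ?thesis
      using s c dom.total_segment_edge[OF \<sigma>, of "cut qs ss s"] unfolding lhs
      by (simp add: insert_args_def map_args_nth[OF \<sigma>])
  next
    fix i assume i: "i < length qs" "map_of (zip ss \<psi>s) s = Some (\<psi>s ! i)" "map_of (zip ss \<phi>s) s = Some (\<phi>s ! i)"
      "cut qs ss (Suc s) = cut qs ss s + qs ! i"
    have "segment (cut qs ss s) (cut qs ss (Suc s)) \<sigma> \<in> simplices V b (qs ! i)"
      using segment_simplex[OF \<sigma> c] i(4) by simp
    then have "Fmor F (total V (segment (cut qs ss s) (cut qs ss (Suc s)) \<sigma>)) (vert \<sigma> ! cut qs ss s) (vert \<sigma> ! cut qs ss (Suc s))
        ((\<psi>s ! i) (segment (cut qs ss s) (cut qs ss (Suc s)) \<sigma>) (seg_args (cut qs ss s) (cut qs ss (Suc s)) as)) =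
      (\<phi>s ! i) (segment (cut qs ss s) (cut qs ss (Suc s)) (map_simplex F \<sigma>))
        (seg_args (cut qs ss s) (cut qs ss (Suc s)) (map_args F \<sigma> as))"
      using intertwinesD[OF int[OF i(1)] _ seg_args_closed[OF \<sigma> c as]]
      by (simp add: segment_ends[OF \<sigma> c] flip: map_simplex_segment map_args_segment[OF \<sigma> c as])
    then show ?thesis
      using s i(2,3) unfolding lhs by (simp add: insert_args_def)
  qed
qed

text \<open>The sum runs over the same insertions with the same signs on both sides, so it suffices to compare
  the terms: transporting the value by \<open>F\<close> is the relation for the outer cochain at the contracted
  simplex, whose arguments are compared by the relations for the inserted ones.\<close>

lemma intertwines_brace:
  assumes \<psi>: "\<psi> \<in> carrier (cochains k V b (unit_bimodule b) p)" "intertwines V b F (Fmor F) p \<psi> \<phi>"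
    and \<psi>s: "homogeneous (cochains k V b (unit_bimodule b)) qs \<psi>s" and l: "length \<phi>s = length qs"
    and int: "\<And>i. i < length qs \<Longrightarrow> intertwines V b F (Fmor F) (qs ! i) (\<psi>s ! i) (\<phi>s ! i)"
  shows "intertwines V b F (Fmor F) (p + sum_list qs - length qs) (brace V b p \<psi> qs \<psi>s) (brace U a p \<phi> qs \<phi>s)"
  unfolding intertwines_def
proof (intro ballI)
  interpret coefficient_hom k V b U a F "unit_bimodule a" "unit_bimodule b" "Fmor F"
    by (rule Fmor_coefficient_hom)
  fix \<sigma> as assume \<sigma>: "\<sigma> \<in> simplices V b (p + sum_list qs - length qs)" and as: "as \<in> args b \<sigma>"
  have l': "length \<psi>s = length qs" using \<psi>s by (simp add: homogeneous_def list_all2_lengthD)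
  let ?\<tau> = "map_simplex F \<sigma>" and ?cs = "map_args F \<sigma> as"
  let ?N = "coeff V (unit_bimodule b) \<sigma>" and ?M = "coeff U (unit_bimodule a) ?\<tau>"
  let ?e = "\<lambda>ss. \<Sum>i<length qs. (qs ! i + 1) * ss ! i"
  let ?f = "\<lambda>ss. \<psi> (contract V p qs ss \<sigma>) (insert_args p qs \<psi>s ss \<sigma> as)"
  let ?g = "\<lambda>ss. \<phi> (contract U p qs ss ?\<tau>) (insert_args p qs \<phi>s ss ?\<tau> ?cs)"
  interpret H: linear_map k ?N ?M "H \<sigma>" by (rule H_linear[OF \<sigma>])
  note S = signed_closed[OF H.M.module_axioms]
  have closed: "?f ss \<in> carrier ?N" if "ss \<in> insertions p (length qs)" for ss
    by (rule dom.brace_term_closed[OF \<sigma> that \<psi>(1) \<psi>s as])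
  have g: "?g ss = H \<sigma> (?f ss)" if ss: "ss \<in> insertions p (length qs)" for ss
    using intertwinesD[OF \<psi>(2) dom.contract_simplex[OF \<sigma> ss] dom.insert_args_closed[OF \<sigma> ss \<psi>s as]]
    by (simp add: dom.total_contract[OF \<sigma> ss] flip: map_simplex_contract[OF \<sigma> ss]
        map_args_insert_args[OF \<sigma> ss as l' l int])
  have "H \<sigma> (brace V b p \<psi> qs \<psi>s \<sigma> as) =
      (\<Oplus>\<^bsub>?M\<^esub> ss \<in> insertions p (length qs). H \<sigma> (signed ?N (?e ss) (?f ss)))"
    using \<sigma> as by (simp add: brace_def H.map_finsum S closed)
  also have "\<dots> = (\<Oplus>\<^bsub>?M\<^esub> ss \<in> insertions p (length qs). signed ?M (?e ss) (?g ss))"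
  proof (rule H.N.M.finsum_cong'[OF refl])
    show "(\<lambda>ss. signed ?M (?e ss) (?g ss)) \<in> insertions p (length qs) \<rightarrow> carrier ?M"
      using closed by (auto simp: g intro!: signed_closed[OF H.N.module_axioms] H.closed)
  qed (simp add: g H.map_signed closed)
  also have "\<dots> = brace U a p \<phi> qs \<phi>s ?\<tau> ?cs"
    using map_simplex_simplex[OF \<sigma>] map_args_closed[OF \<sigma> as] by (simp add: brace_def)
  finally show "H \<sigma> (brace V b p \<psi> qs \<psi>s \<sigma> as) = brace U a p \<phi> qs \<phi>s ?\<tau> ?cs" .
qed

end

lemma bmult_other:
  assumes "length xs = length ds" "length ds \<noteq> 1" "\<not> (ds = [] \<and> length es = 1)"
  shows "bmult (hochschild_B_infinity k U a) ds xs es ys =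
    \<zero>\<^bsub>cochains k U a (unit_bimodule a) (nat (mult_degree ds es))\<^esub>"
proof -
  consider "ds = []" "es = []" | e e' es' where "ds = []" "es = e # e' # es'" | d d' ds' where "ds = d # d' # ds'"
    using assms(2,3) by (cases ds rule: remdups_adj.cases; cases es rule: remdups_adj.cases) auto
  then show ?thesis using assms(1) by cases (simp_all add: hochschild_B_infinity_def Let_def)
qed


section \<open>Subcartesian functors\<close>

context subcartesian_functor
begin

lemma Fmor_inv_iso:
  assumes v: "v \<in> Arr V" "B \<in> obs b (src V v)" "B' \<in> obs b (tgt V v)"
  shows "linear_iso k (Mor a (farr F v) (Fob F (src V v) B) (Fob F (tgt V v) B')) (Mor b v B B') (Fmor_inv b F v B B')"
  unfolding Fmor_inv_def by (rule linear_map_inv[OF Fmor_iso[OF v]])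

lemma Fmor_inv_Fmor:
  assumes v: "v \<in> Arr V" "B \<in> obs b (src V v)" "B' \<in> obs b (tgt V v)" and "x \<in> carrier (Mor b v B B')"
  shows "Fmor_inv b F v B B' (Fmor F v B B' x) = x"
  using Fmor_iso[OF v] assms(4) by (auto simp: Fmor_inv_def linear_iso_def bij_betw_inv_into_left)

lemma Fmor_Fmor_inv:
  assumes v: "v \<in> Arr V" "B \<in> obs b (src V v)" "B' \<in> obs b (tgt V v)"
    and "y \<in> carrier (Mor a (farr F v) (Fob F (src V v) B) (Fob F (tgt V v) B'))"
  shows "Fmor F v B B' (Fmor_inv b F v B B' y) = y"
  using Fmor_iso[OF v] assms(4) by (auto simp: Fmor_inv_def linear_iso_def bij_betw_inv_into_right)

text \<open>Compatibility with the actions holds for \<open>F\<close>; applying it to the preimages of the arguments gives it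
  for the inverse.\<close>

lemma Fmor_inv_bimodule_iso:
  "bimodule_iso k V b (pullback_bimodule V F (unit_bimodule a)) (unit_bimodule b) (Fmor_inv b F)"
proof (intro bimodule_iso.intro bimodule_iso_axioms.intro dom.unit_bimodule_bimodule
    pullback_bimodule_bimodule cod.unit_bimodule_bimodule)
  let ?P = "pullback_bimodule V F (unit_bimodule a)"
  show "linear_iso k (Bm ?P v B B') (Bm (unit_bimodule b) v B B') (Fmor_inv b F v B B')"
    if "v \<in> Arr V" "B \<in> obs b (src V v)" "B' \<in> obs b (tgt V v)" for v B B'
    using Fmor_inv_iso[OF that] by (simp add: pullback_bimodule_def unit_bimodule_def)
  fix v w B B' B''
  assume A: "v \<in> Arr V" "w \<in> Arr V" "tgt V v = src V w"
    "B \<in> obs b (src V v)" "B' \<in> obs b (tgt V v)" "B'' \<in> obs b (tgt V w)"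
  have wv: "ccomp V w v \<in> Arr V" "B \<in> obs b (src V (ccomp V w v))" "B'' \<in> obs b (tgt V (ccomp V w v))"
    using A by (simp_all add: dom.comp_arr dom.src_comp dom.tgt_comp)
  note inv_closed = linear_map.closed[OF linear_iso_def[THEN iffD1, OF Fmor_inv_iso, THEN conjunct1]]
  show "Fmor_inv b F (ccomp V w v) B B'' (lact ?P w v B B' B'' x y) = lact (unit_bimodule b) w v B B' B'' x (Fmor_inv b F v B B' y)"
    if x: "x \<in> carrier (Mor b w B' B'')" and y: "y \<in> carrier (Bm ?P v B B')" for x y
  proof -
    let ?y = "Fmor_inv b F v B B' y"
    have y': "y \<in> carrier (Mor a (farr F v) (Fob F (src V v) B) (Fob F (tgt V v) B'))"
      using y by (simp add: pullback_bimodule_def unit_bimodule_def)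
    have yi: "?y \<in> carrier (Mor b v B B')" by (rule inv_closed) (use A y' in simp_all)
    have "lact ?P w v B B' B'' x y = Fmor F (ccomp V w v) B B'' (mcomp b w v B B' B'' x ?y)"
      using A x yi y' by (simp add: pullback_bimodule_def unit_bimodule_def Fmor_comp Fmor_Fmor_inv)
    then show ?thesis
      using Fmor_inv_Fmor[OF wv dom.mcomp_closed[OF A _ yi, of x]] A x by (simp add: unit_bimodule_def)
  qed
  show "Fmor_inv b F (ccomp V w v) B B'' (ract ?P w v B B' B'' x y) = ract (unit_bimodule b) w v B B' B'' (Fmor_inv b F w B' B'' x) y"
    if x: "x \<in> carrier (Bm ?P w B' B'')" and y: "y \<in> carrier (Mor b v B B')" for x y
  proof -
    let ?x = "Fmor_inv b F w B' B'' x"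
    have x': "x \<in> carrier (Mor a (farr F w) (Fob F (src V w) B') (Fob F (tgt V w) B''))"
      using x by (simp add: pullback_bimodule_def unit_bimodule_def)
    have xi: "?x \<in> carrier (Mor b w B' B'')" by (rule inv_closed) (use A x' in simp_all)
    have "ract ?P w v B B' B'' x y = Fmor F (ccomp V w v) B B'' (mcomp b w v B B' B'' ?x y)"
      using A y xi x' by (simp add: pullback_bimodule_def unit_bimodule_def Fmor_comp Fmor_Fmor_inv)
    then show ?thesis
      using Fmor_inv_Fmor[OF wv dom.mcomp_closed[OF A xi y]] by (simp add: unit_bimodule_def)
  qed
qed

lemma F_star_linear:
  "linear_map k (cochains k U a (unit_bimodule a) n) (cochains k V b (unit_bimodule b) n) (F_star V b F n)"
proof -
  interpret I: bimodule_iso k V b "pullback_bimodule V F (unit_bimodule a)" "unit_bimodule b" "Fmor_inv b F"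
    by (rule Fmor_inv_bimodule_iso)
  show ?thesis
    unfolding F_star_def
    by (rule linear_map_comp[OF pullback_cochain_linear[OF cod.unit_bimodule_bimodule]
          coeff_map_linear[OF I.M.bimodule_axioms I.N.bimodule_axioms]])
      (use I.iso in \<open>simp add: linear_iso_def\<close>)
qed

lemma F_star_apply:
  assumes "\<sigma> \<in> simplices V b n" "as \<in> args b \<sigma>"
  shows "F_star V b F n \<phi> \<sigma> as =
    Fmor_inv b F (total V \<sigma>) (hd (vert \<sigma>)) (last (vert \<sigma>)) (\<phi> (map_simplex F \<sigma>) (map_args F \<sigma> as))"
  using assms by (simp add: F_star_def coeff_map_def pullback_cochain_def)

lemma simplex_ends_obs:
  assumes \<sigma>: "\<sigma> \<in> simplices V b n"
  shows "total V \<sigma> \<in> Arr V" "hd (vert \<sigma>) \<in> obs b (src V (total V \<sigma>))" "last (vert \<sigma>) \<in> obs b (tgt V (total V \<sigma>))"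
  using simplexD(2)[OF \<sigma>, of 0] simplexD(2)[OF \<sigma>, of n]
  by (simp_all add: dom.total_closed[OF \<sigma>] simplex_ends[OF \<sigma>])

lemma F_star_intertwines:
  assumes \<phi>: "\<phi> \<in> carrier (cochains k U a (unit_bimodule a) n)"
  shows "intertwines V b F (Fmor F) n (F_star V b F n \<phi>) \<phi>"
  unfolding intertwines_def
proof (intro ballI)
  fix \<sigma> as assume s: "\<sigma> \<in> simplices V b n" "as \<in> args b \<sigma>"
  show "Fmor F (total V \<sigma>) (hd (vert \<sigma>)) (last (vert \<sigma>)) (F_star V b F n \<phi> \<sigma> as) = \<phi> (map_simplex F \<sigma>) (map_args F \<sigma> as)"
    unfolding F_star_apply[OF s]
    using cochain_closed[OF \<phi> map_simplex_simplex[OF s(1)] map_args_closed[OF s]]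
    by (intro Fmor_Fmor_inv simplex_ends_obs[OF s(1)])
      (simp add: coeff_unit_bimodule total_map_simplex[OF s(1)] map_simplex_ends[OF s(1)])
qed

text \<open>As \<open>F\<close> is injective on morphisms, at most one cochain on \<open>b\<close> intertwines with \<open>\<phi>\<close>. This is how the
  naturality statements for the operations become equations for \<open>F\<^sup>*\<close>.\<close>

lemma F_star_eqI:
  assumes int: "intertwines V b F (Fmor F) n \<psi> \<phi>"
    and closed: "\<And>\<sigma> as. \<lbrakk>\<sigma> \<in> simplices V b n; as \<in> args b \<sigma>\<rbrakk> \<Longrightarrow> \<psi> \<sigma> as \<in> carrier (coeff V (unit_bimodule b) \<sigma>)"
    and ext: "\<psi> = (\<lambda>\<sigma> \<in> simplices V b n. \<lambda>as \<in> args b \<sigma>. \<psi> \<sigma> as)"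
  shows "F_star V b F n \<phi> = \<psi>"
proof -
  have "F_star V b F n \<phi> \<sigma> as = \<psi> \<sigma> as" if s: "\<sigma> \<in> simplices V b n" "as \<in> args b \<sigma>" for \<sigma> as
  proof -
    have "\<phi> (map_simplex F \<sigma>) (map_args F \<sigma> as) = Fmor F (total V \<sigma>) (hd (vert \<sigma>)) (last (vert \<sigma>)) (\<psi> \<sigma> as)"
      using int s by (simp add: intertwines_def)
    then show ?thesis
      using closed[OF s] by (simp add: F_star_apply[OF s] Fmor_inv_Fmor simplex_ends_obs[OF s(1)] coeff_unit_bimodule)
  qed
  moreover have "F_star V b F n \<phi> = (\<lambda>\<sigma> \<in> simplices V b n. \<lambda>as \<in> args b \<sigma>. F_star V b F n \<phi> \<sigma> as)"
    by (simp add: F_star_def coeff_map_def fun_eq_iff)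
  ultimately show ?thesis
    by (subst ext, simp only:) (simp cong: restrict_cong)
qed

lemma F_star_hochschild_d:
  assumes \<phi>: "\<phi> \<in> carrier (cochains k U a (unit_bimodule a) n)"
  shows "F_star V b F (Suc n) (hochschild_d U a (unit_bimodule a) n \<phi>) =
    hochschild_d V b (unit_bimodule b) n (F_star V b F n \<phi>)"
proof -
  interpret coefficient_hom k V b U a F "unit_bimodule a" "unit_bimodule b" "Fmor F"
    by (rule Fmor_coefficient_hom)
  note closed = linear_map.closed[OF F_star_linear \<phi>]
  show ?thesis
    by (rule F_star_eqI[OF intertwines_hochschild_d[OF closed F_star_intertwines[OF \<phi>]] N.hochschild_d_closed[OF _ _ closed]])
      (simp_all add: hochschild_d_def fun_eq_iff)
qed

lemma F_star_cup:
  assumes \<phi>: "\<phi> \<in> carrier (cochains k U a (unit_bimodule a) p)"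
    and \<psi>: "\<psi> \<in> carrier (cochains k U a (unit_bimodule a) q)"
  shows "F_star V b F (p + q) (cup U a p \<phi> q \<psi>) = cup V b p (F_star V b F p \<phi>) q (F_star V b F q \<psi>)"
proof -
  note closed = linear_map.closed[OF F_star_linear \<phi>] linear_map.closed[OF F_star_linear \<psi>]
  show ?thesis
    by (rule F_star_eqI[OF intertwines_cup[OF closed(1) F_star_intertwines[OF \<phi>] closed(2) F_star_intertwines[OF \<psi>]]
          cochain_closed[OF dom.cup_closed[OF closed]]])
      (simp_all add: cup_def fun_eq_iff)
qed

lemma F_star_brace:
  assumes \<phi>: "\<phi> \<in> carrier (cochains k U a (unit_bimodule a) p)"
    and \<psi>s: "homogeneous (cochains k U a (unit_bimodule a)) qs \<psi>s"
  shows "F_star V b F (p + sum_list qs - length qs) (brace U a p \<phi> qs \<psi>s) =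
    brace V b p (F_star V b F p \<phi>) qs (map2 (F_star V b F) qs \<psi>s)"
proof -
  have l: "length \<psi>s = length qs" and \<psi>: "\<And>i. i < length qs \<Longrightarrow> \<psi>s ! i \<in> carrier (cochains k U a (unit_bimodule a) (qs ! i))"
    using \<psi>s by (simp_all add: homogeneous_def list_all2_conv_all_nth)
  note closed = linear_map.closed[OF F_star_linear \<phi>]
  have closeds: "homogeneous (cochains k V b (unit_bimodule b)) qs (map2 (F_star V b F) qs \<psi>s)"
    using l \<psi> linear_map.closed[OF F_star_linear] by (simp add: homogeneous_def list_all2_conv_all_nth)
  show ?thesis
  proof (rule F_star_eqI[OF intertwines_brace[OF closed F_star_intertwines[OF \<phi>] closeds l] dom.brace_value_closed[OF closed closeds]])
    show "intertwines V b F (Fmor F) (qs ! i) (map2 (F_star V b F) qs \<psi>s ! i) (\<psi>s ! i)" if "i < length qs" for i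
      using that l F_star_intertwines[OF \<psi>[OF that]] by simp
  qed (simp_all add: brace_def fun_eq_iff)
qed

text \<open>The components that vanish correspond because \<open>F\<^sup>*\<close> preserves zero. The others are the differential,
  the cup product, the braces, and one component that is the identity.\<close>

lemma F_star_B_infinity_hom:
  "B_infinity_hom k (hochschild_B_infinity k U a) (hochschild_B_infinity k V b) (F_star V b F)"
proof -
  let ?C = "cochains k U a (unit_bimodule a)" and ?D = "cochains k V b (unit_bimodule b)"
  let ?A = "hochschild_B_infinity k U a" and ?B = "hochschild_B_infinity k V b"
  note zero = linear_map.map_zero[OF F_star_linear]
  have diff: "F_star V b F n (bdiff ?A ds xs) = bdiff ?B ds (map2 (F_star V b F) ds xs)"
    if h: "homogeneous ?C ds xs" and n: "int n = diff_degree ds" for ds xs n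
  proof -
    have l: "length xs = length ds" using h by (simp add: homogeneous_def list_all2_lengthD)
    have n': "nat (diff_degree ds) = n" using n by simp
    consider "length ds \<noteq> 1 \<and> length ds \<noteq> 2" | "length ds = 1" | "length ds = 2" by blast
    then show ?thesis
    proof cases
      case 1
      then show ?thesis
        using l zero[of n] unfolding n'[symmetric]
        by (auto simp: hochschild_B_infinity_def Let_def split: list.splits)
    next
      case 2
      then obtain p \<phi> where dx: "ds = [p]" "xs = [\<phi>]"
        using l by (auto simp: length_Suc_conv)
      then have "n = Suc p" "\<phi> \<in> carrier (?C p)" using n h by (simp_all add: diff_degree_def homogeneous_def)
      then show ?thesis using dx by (simp add: hochschild_B_infinity_def Let_def F_star_hochschild_d)
    next
      case 3
      then obtain p q \<phi> \<psi> where dx: "ds = [p, q]" "xs = [\<phi>, \<psi>]"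
        using l by (auto simp: length_Suc_conv numeral_2_eq_2)
      then have "n = p + q" "\<phi> \<in> carrier (?C p)" "\<psi> \<in> carrier (?C q)"
        using n h by (simp_all add: diff_degree_def homogeneous_def)
      then show ?thesis
        using dx by (simp add: hochschild_B_infinity_def Let_def linear_map.map_signed[OF F_star_linear] cod.cup_closed F_star_cup)
    qed
  qed
  have mult: "F_star V b F n (bmult ?A ds xs es ys) =
      bmult ?B ds (map2 (F_star V b F) ds xs) es (map2 (F_star V b F) es ys)"
    if h: "homogeneous ?C ds xs" "homogeneous ?C es ys" and n: "int n = mult_degree ds es" for ds xs es ys n
  proof -
    have l: "length xs = length ds" "length ys = length es" using h by (simp_all add: homogeneous_def list_all2_lengthD)
    have n': "nat (mult_degree ds es) = n" using n by simp
    consider "length ds \<noteq> 1 \<and> \<not> (ds = [] \<and> length es = 1)" | "length ds = 1" | "ds = [] \<and> length es = 1" by blast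
    then show ?thesis
    proof cases
      case 1
      then show ?thesis using l zero[of n] by (simp add: bmult_other n')
    next
      case 2
      then obtain p \<phi> where dx: "ds = [p]" "xs = [\<phi>]"
        using l by (auto simp: length_Suc_conv)
      then have "n = p + sum_list es - length es" "\<phi> \<in> carrier (?C p)"
        using n h by (simp_all add: mult_degree_def homogeneous_def)
      then show ?thesis using dx h by (simp add: hochschild_B_infinity_def Let_def F_star_brace)
    next
      case 3
      then obtain q \<psi> where dx: "ds = []" "xs = []" "es = [q]" "ys = [\<psi>]"
        using l by (auto simp: length_Suc_conv)
      then have "n = q" using n by (simp add: mult_degree_def)
      then show ?thesis using dx by (simp add: hochschild_B_infinity_def Let_def)
    qed
  qed
  show ?thesis
    unfolding B_infinity_hom_def
  proof (intro conjI allI impI; (elim conjE)?)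
    show "linear_map k (bgrade ?A n) (bgrade ?B n) (F_star V b F n)" for n
      using F_star_linear by (simp add: hochschild_B_infinity_def Let_def)
  qed (use diff mult in \<open>simp_all add: hochschild_B_infinity_def Let_def\<close>)
qed

end

theorem proposition4p2:
  fixes k :: "('k, 'r) ring_scheme"
    and V :: "('vo, 'v) cat" and b :: "('vo, 'v, 'y, 'k, 'n) gcat"
    and U :: "('uo, 'u) cat" and a :: "('uo, 'u, 'x, 'k, 'm) gcat"
    and F :: "('vo, 'v, 'y, 'n, 'uo, 'u, 'x, 'm) gfun"
    and M :: "('u, 'x, 'k, 'm, 'p) bimod"
  assumes gfun: "graded_functor k V b U a F"
    and bimod: "bimodule k U a M"
  shows "bimodule k V b (pullback_bimodule V F M) \<and>
    (\<forall>n. linear_map k (cochains k U a M n) (cochains k V b (pullback_bimodule V F M) n)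
            (pullback_cochain V b F n) \<and>
         (\<forall>\<phi> \<in> carrier (cochains k U a M n). \<forall>\<sigma> \<in> simplices V b n. \<forall>as \<in> args b \<sigma>.
            pullback_cochain V b F n \<phi> \<sigma> as = \<phi> (map_simplex F \<sigma>) (map_args F \<sigma> as))) \<and>
    complex_hom k (hochschild_complex k U a M)
      (hochschild_complex k V b (pullback_bimodule V F M)) (pullback_cochain V b F) \<and>
    (subcartesian_functor k V b U a F \<longrightarrow>
       bimodule_iso k V b (pullback_bimodule V F (unit_bimodule a)) (unit_bimodule b) (Fmor_inv b F) \<and>
       B_infinity_hom k (hochschild_B_infinity k U a) (hochschild_B_infinity k V b) (F_star V b F) \<and>
       (\<forall>n. \<forall>\<phi> \<in> carrier (cochains k U a (unit_bimodule a) n).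
          \<forall>\<sigma> \<in> simplices V b n. \<forall>as \<in> args b \<sigma>.
            F_star V b F n \<phi> \<sigma> as =
              Fmor_inv b F (total V \<sigma>) (hd (vert \<sigma>)) (last (vert \<sigma>))
                (\<phi> (map_simplex F \<sigma>) (map_args F \<sigma> as))))"
proof -
  interpret graded_functor k V b U a F by (rule gfun)
  show ?thesis
  proof (intro conjI impI)
    show "bimodule k V b (pullback_bimodule V F M)"
      by (rule pullback_bimodule_bimodule[OF bimod])
    show "\<forall>n. linear_map k (cochains k U a M n) (cochains k V b (pullback_bimodule V F M) n)
            (pullback_cochain V b F n) \<and>
         (\<forall>\<phi> \<in> carrier (cochains k U a M n). \<forall>\<sigma> \<in> simplices V b n. \<forall>as \<in> args b \<sigma>.
            pullback_cochain V b F n \<phi> \<sigma> as = \<phi> (map_simplex F \<sigma>) (map_args F \<sigma> as))"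
      by (simp add: pullback_cochain_linear[OF bimod]) (simp add: pullback_cochain_def)
    show "complex_hom k (hochschild_complex k U a M)
      (hochschild_complex k V b (pullback_bimodule V F M)) (pullback_cochain V b F)"
      by (simp add: complex_hom_def hochschild_complex_def pullback_cochain_linear[OF bimod]
          pullback_cochain_hochschild_d[OF bimod])
  next
    assume "subcartesian_functor k V b U a F"
    then interpret subcartesian_functor k V b U a F .
    show "bimodule_iso k V b (pullback_bimodule V F (unit_bimodule a)) (unit_bimodule b) (Fmor_inv b F)"
      by (rule Fmor_inv_bimodule_iso)
    show "B_infinity_hom k (hochschild_B_infinity k U a) (hochschild_B_infinity k V b) (F_star V b F)"
      by (rule F_star_B_infinity_hom)
    show "\<forall>n. \<forall>\<phi> \<in> carrier (cochains k U a (unit_bimodule a) n).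
          \<forall>\<sigma> \<in> simplices V b n. \<forall>as \<in> args b \<sigma>.
            F_star V b F n \<phi> \<sigma> as =
              Fmor_inv b F (total V \<sigma>) (hd (vert \<sigma>)) (last (vert \<sigma>))
                (\<phi> (map_simplex F \<sigma>) (map_args F \<sigma> as))"
      by (simp add: F_star_apply)
  qed
qed

end
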